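(* Let $k\ge3$ and $2\le i\le k-1$. For every $n\ge0$, the number of superpartitions $(\lambda_1,\dots,\lambda_s)$ of $n$ such that, for all $\ell$ with $\ell+k-1\le s$, $\lambda_\ell-\lambda_{\ell+k-1}\ge1$ if $\lambda_\ell$ is overlined and $\lambda_\ell-\lambda_{\ell+k-1}\ge2$ otherwise, and such that the number of non-overlined parts equal to $1$ plus the number of parts $\overline{0}$ is at most $i-1$, equals the number of overpartitions of $n$ whose non-overlined parts are not congruent to $0,\pm i$ modulo $2k$ plus the number of overpartitions of $n$ whose non-overlined parts are not congruent to $0,\pm(i-1)$ modulo $2k$.
   Context: An overpartition of $n$ is a non-increasing sequence of positive integers summing to $n$ in which the final occurrence of each value may be overlined. A superpartition of $n$ is a non-increasing sequence of parts summing to $n$ in which the first occurrence of each value may be overlined and the part $\overline{0}$ may appear (at most once); non-overlined parts are positive integers and overlined parts are distinct nonnegative integers. *)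

theory Defs
  imports Main "HOL-Number_Theory.Cong"
begin

text \<open>A part is a value together with a flag saying whether it is overlined.\<close>

type_synonym part = "nat \<times> bool"

abbreviation val :: "part \<Rightarrow> nat" where
  "val \<equiv> fst"

abbreviation overlined :: "part \<Rightarrow> bool" where
  "overlined \<equiv> snd"

definition overpartition :: "nat \<Rightarrow> part list \<Rightarrow> bool" where
  "overpartition n xs \<longleftrightarrow>
     sorted_wrt (\<ge>) (map val xs) \<and>
     (\<forall>p\<in>set xs. val p > 0) \<and>
     (\<forall>j<length xs. overlined (xs ! j) \<longrightarrow>
        (\<forall>l<length xs. j < l \<longrightarrow> val (xs ! l) \<noteq> val (xs ! j))) \<and>
     sum_list (map val xs) = n"

text \<open>The overlined part 0 is not a separate case: it is the only part of value 0 allowed, and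
  since only a first occurrence can be overlined it appears at most once.\<close>

definition superpartition :: "nat \<Rightarrow> part list \<Rightarrow> bool" where
  "superpartition n xs \<longleftrightarrow>
     sorted_wrt (\<ge>) (map val xs) \<and>
     (\<forall>p\<in>set xs. \<not> overlined p \<longrightarrow> val p > 0) \<and>
     (\<forall>j<length xs. overlined (xs ! j) \<longrightarrow> (\<forall>l<j. val (xs ! l) \<noteq> val (xs ! j))) \<and>
     sum_list (map val xs) = n"

definition difference_condition :: "nat \<Rightarrow> part list \<Rightarrow> bool" where
  "difference_condition k xs \<longleftrightarrow>
     (\<forall>l. l + (k - 1) < length xs \<longrightarrow>
        int (val (xs ! l)) - int (val (xs ! (l + (k - 1))))
          \<ge> (if overlined (xs ! l) then 1 else 2))"

definition nonoverlined_avoid :: "nat \<Rightarrow> nat \<Rightarrow> part list \<Rightarrow> bool" where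
  "nonoverlined_avoid k i xs \<longleftrightarrow>
     (\<forall>p\<in>set xs. \<not> overlined p \<longrightarrow>
        \<not> [int (val p) = 0] (mod 2 * int k) \<and>
        \<not> [int (val p) = int i] (mod 2 * int k) \<and>
        \<not> [int (val p) = - int i] (mod 2 * int k))"

end

theory Submission
  imports Defs "HOL-Computational_Algebra.Formal_Power_Series"
begin

text \<open>
  Let f(v) and g(v) be the numbers of non-overlined and overlined parts of value v. The difference
  condition says that f(v+1) + f(v) + g(v) < k for all v. Let D(m,j) be the generating function of
  such configurations with all parts at least m and f(m) < j. Removing the parts equal to m gives
  D(m,j+1) = D(m,j) + q^(mj) D(m+1,k-j) + q^(m(j+1)) D(m+1,k-j-1), and since D(m,j) tends to 1 as
  m grows (for j > 0) this system has a unique solution. It is solved by Andrews' series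
  H_{k,j}(a;x;q) at a = -1/q, x = q^m, which for m = 1 is the infinite product
  (1+q)(1+q^2).../((1-q)(1-q^2)...) times a theta series. The Jacobi triple product turns this into
  the generating function of the overpartitions whose non-overlined parts avoid 0, j, -j modulo 2k.
  Superpartitions without and with the part 0 are counted by D(1,i) and D(1,i-1), respectively.

  Instead of passing to limits, infinite sums and products are truncated and compared modulo a power
  of q.
\<close>

section \<open>Superpartitions\<close>

text \<open>\<open>sorted_wrt\<close> compares every earlier part p with every later part r, so one
  relation carries both the ordering and the rule that only a first occurrence is overlined.
  \<open>over_rel\<close> puts the strictness on p instead, for final occurrences.\<close>

definition super_rel :: "part \<Rightarrow> part \<Rightarrow> bool" where
  "super_rel p r \<longleftrightarrow> val r \<le> val p \<and> (overlined r \<longrightarrow> val r < val p)"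

definition over_rel :: "part \<Rightarrow> part \<Rightarrow> bool" where
  "over_rel p r \<longleftrightarrow> val r \<le> val p \<and> (overlined p \<longrightarrow> val r < val p)"

lemma superpartition_iff:
  "superpartition n xs \<longleftrightarrow>
     sorted_wrt super_rel xs \<and> (0, False) \<notin> set xs \<and> sum_list (map val xs) = n"
proof -
  have "(\<forall>p\<in>set xs. \<not> overlined p \<longrightarrow> val p > 0) \<longleftrightarrow> (0, False) \<notin> set xs"
    by (auto simp: Ball_def intro!: gr0I)
  moreover have "sorted_wrt super_rel xs \<longleftrightarrow> sorted_wrt (\<ge>) (map val xs) \<and>
     (\<forall>j<length xs. overlined (xs ! j) \<longrightarrow> (\<forall>l<j. val (xs ! l) \<noteq> val (xs ! j)))"
    unfolding sorted_wrt_iff_nth_less super_rel_def by (fastforce simp: le_less)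
  ultimately show ?thesis
    unfolding superpartition_def by argo
qed

lemma overpartition_iff:
  "overpartition n xs \<longleftrightarrow>
     sorted_wrt over_rel xs \<and> (\<forall>p\<in>set xs. val p > 0) \<and> sum_list (map val xs) = n"
proof -
  have "sorted_wrt over_rel xs \<longleftrightarrow> sorted_wrt (\<ge>) (map val xs) \<and>
     (\<forall>j<length xs. overlined (xs ! j) \<longrightarrow>
        (\<forall>l<length xs. j < l \<longrightarrow> val (xs ! l) \<noteq> val (xs ! j)))"
    (is "?l \<longleftrightarrow> ?r")
  proof
    assume ?l
    thus ?r by (fastforce simp: sorted_wrt_iff_nth_less over_rel_def)
  next
    assume ?r
    thus ?l by (auto simp: sorted_wrt_iff_nth_less over_rel_def less_le)
  qed
  thus ?thesis
    unfolding overpartition_def by argo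
qed

section \<open>The difference condition as a bound on multiplicities of neighbouring values\<close>

definition occupancy_bounded :: "nat \<Rightarrow> part list \<Rightarrow> bool" where
  "occupancy_bounded k xs \<longleftrightarrow>
     (\<forall>v. count_list xs (Suc v, False) + count_list xs (v, True) + count_list xs (v, False) < k)"

lemma filter_append_filter_Not:
  assumes "sorted_wrt R xs" and "\<And>x y. R x y \<Longrightarrow> P y \<Longrightarrow> P x"
  shows "xs = filter P xs @ filter (\<lambda>x. \<not> P x) xs"
  using assms(1)
proof (induction xs)
  case (Cons x xs)
  show ?case
  proof (cases "P x")
    case False
    hence "filter P xs = []"
      using Cons.prems assms(2) by (auto simp: filter_empty_conv)
    thus ?thesis using False Cons by simp
  qed (use Cons in simp)
qed simp

text \<open>Within each value the overlined part comes first, so the non-overlined parts v+1 and all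
  parts v stand next to each other. P cuts off the parts before this block and Q fails exactly on
  the parts after it.\<close>

lemma block_contiguous:
  assumes "sorted_wrt super_rel xs"
  obtains as bs cs where "xs = as @ bs @ cs"
    and "set bs \<subseteq> {(Suc v, False), (v, True), (v, False)}"
    and "length bs = count_list xs (Suc v, False) + count_list xs (v, True) + count_list xs (v, False)"
proof -
  define P where "P = (\<lambda>p::part. Suc v < val p \<or> p = (Suc v, True))"
  define Q where "Q = (\<lambda>p::part. v \<le> val p)"
  have 1: "xs = filter P xs @ filter (\<lambda>x. \<not> P x) xs"
    by (rule filter_append_filter_Not[OF assms]) (auto simp: P_def super_rel_def)
  have "filter (\<lambda>x. \<not> P x) xs = filter Q (filter (\<lambda>x. \<not> P x) xs) @
      filter (\<lambda>x. \<not> Q x) (filter (\<lambda>x. \<not> P x) xs)"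
    by (rule filter_append_filter_Not[of super_rel])
      (use assms in \<open>auto simp: Q_def super_rel_def sorted_wrt_filter\<close>)
  with 1 have "xs = filter P xs @ filter Q (filter (\<lambda>x. \<not> P x) xs) @
      filter (\<lambda>x. \<not> Q x) (filter (\<lambda>x. \<not> P x) xs)" by simp
  moreover have W: "Q p \<and> \<not> P p \<longleftrightarrow> p \<in> {(Suc v, False), (v, True), (v, False)}" for p
    by (cases p) (auto simp: P_def Q_def)
  have "set (filter Q (filter (\<lambda>x. \<not> P x) xs)) \<subseteq> {(Suc v, False), (v, True), (v, False)}"
    using W by (simp only: subset_iff set_filter mem_Collect_eq) blast
  moreover have "length (filter Q (filter (\<lambda>x. \<not> P x) xs)) =
     count_list xs (Suc v, False) + count_list xs (v, True) + count_list xs (v, False)"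
  proof (induction xs)
    case (Cons p xs)
    thus ?case using W[of p] by auto
  qed simp
  ultimately show ?thesis using that by blast
qed

text \<open>If the block of v has k parts, its first and k-th entries violate the condition: they
  differ by at most 0 when the first is overlined (its value is then v) and by at most 1
  otherwise.\<close>

lemma difference_condition_imp_occupancy_bounded:
  assumes "sorted_wrt super_rel xs" and "k \<ge> 1" and "difference_condition k xs"
  shows "occupancy_bounded k xs"
  unfolding occupancy_bounded_def
proof (rule allI, rule ccontr)
  fix v
  assume "\<not> count_list xs (Suc v, False) + count_list xs (v, True) + count_list xs (v, False) < k"
  moreover obtain as bs cs where xs: "xs = as @ bs @ cs"
    and bs: "set bs \<subseteq> {(Suc v, False), (v, True), (v, False)}"
    and "length bs = count_list xs (Suc v, False) + count_list xs (v, True) + count_list xs (v, False)"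
    using block_contiguous[OF assms(1)] .
  ultimately have len: "k \<le> length bs" by simp
  define l where "l = length as"
  have nth: "xs ! (l + a) = bs ! a" if "a < length bs" for a
    using that by (simp add: xs l_def nth_append)
  have "l + (k - 1) < length xs" using len assms(2) by (simp add: xs l_def)
  hence "int (val (xs ! l)) - int (val (xs ! (l + (k - 1)))) \<ge> (if overlined (xs ! l) then 1 else 2)"
    using assms(3) unfolding difference_condition_def by blast
  moreover have "xs ! l = bs ! 0" "xs ! (l + (k - 1)) = bs ! (k - 1)"
    using nth[of 0] nth[of "k - 1"] len assms(2) by fastforce+
  moreover have "bs ! 0 \<in> set bs" "bs ! (k - 1) \<in> set bs"
    using len assms(2) by (auto intro!: nth_mem)
  hence "bs ! 0 \<in> {(Suc v, False), (v, True), (v, False)}"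
    "bs ! (k - 1) \<in> {(Suc v, False), (v, True), (v, False)}"
    using bs by blast+
  ultimately show False by auto
qed

text \<open>Conversely, a violation at l gives a window of k consecutive parts, all of which lie in
  the block of a single v; the bound at this v then fails.\<close>

lemma occupancy_bounded_imp_difference_condition:
  assumes sorted: "sorted_wrt super_rel xs" and pos: "(0, False) \<notin> set xs"
    and "k \<ge> 1" and occ: "occupancy_bounded k xs"
  shows "difference_condition k xs"
  unfolding difference_condition_def
proof (intro allI impI, rule ccontr)
  fix l
  assume l: "l + (k - 1) < length xs"
    and viol: "\<not> (if overlined (xs ! l) then 1 else 2)
      \<le> int (val (xs ! l)) - int (val (xs ! (l + (k - 1))))"
  define bs where "bs = take k (drop l xs)"
  have xs: "xs = take l xs @ bs @ drop k (drop l xs)"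
    unfolding bs_def by (metis append_take_drop_id)
  have len: "length bs = k" using l \<open>k \<ge> 1\<close> by (simp add: bs_def)
  have rel: "super_rel (xs ! a) (xs ! b)" if "a < b" "b < length xs" for a b
    using sorted that by (simp add: sorted_wrt_iff_nth_less)
  have bs_elem: "\<exists>a. l \<le> a \<and> a \<le> l + (k - 1) \<and> p = xs ! a" if p: "p \<in> set bs" for p
  proof -
    obtain b where "b < length bs" "bs ! b = p" using p by (auto simp: in_set_conv_nth)
    moreover have "b < k" using \<open>b < length bs\<close> len by simp
    hence "bs ! b = xs ! (l + b)" using l by (simp add: bs_def)
    moreover have "l + b \<le> l + (k - 1)" using \<open>b < k\<close> by simp
    ultimately show ?thesis by (metis le_add1)
  qed
  \<comment> \<open>The first part of the window must belong to the block of v and open it, so it is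
    either v overlined or v+1 not overlined. The truncated subtraction is harmless because a
    non-overlined 0 is excluded.\<close>
  define v where "v = (if overlined (xs ! l) then val (xs ! l) else val (xs ! l) - 1)"
  have "xs ! l \<noteq> (0, False)" using pos nth_mem[OF add_lessD1[OF l]] by auto
  hence v: "xs ! l = (Suc v, False) \<or> xs ! l = (v, True)"
    unfolding v_def by (cases "xs ! l") auto
  have "p \<in> {(Suc v, False), (v, True), (v, False)}" if p: "p \<in> set bs" for p
  proof -
    obtain a where a: "l \<le> a" "a \<le> l + (k - 1)" "p = xs ! a" using bs_elem[OF p] by blast
    have "a = l \<or> super_rel (xs ! l) p"
      using rel[of l a] a l by (metis le_eq_less_or_eq le_less_trans)
    moreover have "a = l + (k - 1) \<or> super_rel p (xs ! (l + (k - 1)))"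
      using rel[of a "l + (k - 1)"] a l by (metis le_eq_less_or_eq)
    ultimately have "val p \<le> val (xs ! l)" "val (xs ! (l + (k - 1))) \<le> val p"
      "overlined p \<Longrightarrow> p = xs ! l \<or> val p < val (xs ! l)"
      using a(3) unfolding super_rel_def by auto
    moreover obtain u w where "p = (u, w)" by fastforce
    ultimately show ?thesis
      using v viol by (cases w) auto
  qed
  hence "length bs \<le> count_list bs (Suc v, False) + count_list bs (v, True) + count_list bs (v, False)"
  proof (induction bs)
    case (Cons b bs)
    have "length bs \<le> count_list bs (Suc v, False) + count_list bs (v, True) + count_list bs (v, False)"
      by (rule Cons.IH) (rule Cons.prems, simp)
    moreover have "b \<in> {(Suc v, False), (v, True), (v, False)}"
      by (rule Cons.prems) simp
    ultimately show ?case by auto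
  qed simp
  also have "\<dots> \<le> count_list xs (Suc v, False) + count_list xs (v, True) + count_list xs (v, False)"
  proof -
    have "count_list bs p \<le> count_list xs p" for p
      using arg_cong[OF xs, of "\<lambda>ys. count_list ys p"] by (simp only: count_list_append)
    thus ?thesis by (intro add_mono)
  qed
  also have "\<dots> < k" using occ by (simp add: occupancy_bounded_def)
  finally show False using len by simp
qed

section \<open>Removing the parts of smallest value\<close>

definition tail_block :: "nat \<Rightarrow> bool \<Rightarrow> nat \<Rightarrow> part list" where
  "tail_block m b c = (if b then [(m, True)] else []) @ replicate c (m, False)"

lemma count_list_replicate: "count_list (replicate c x) y = (if x = y then c else 0)"
  by (induction c) auto

lemma count_list_tail_block [simp]:
  "count_list (tail_block m b c) (v, True) = (if v = m \<and> b then 1 else 0)"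
  "count_list (tail_block m b c) (v, False) = (if v = m then c else 0)"
  by (auto simp: tail_block_def count_list_replicate)

lemma set_tail_block: "p \<in> set (tail_block m b c) \<Longrightarrow> val p = m"
  by (auto simp: tail_block_def split: if_splits)

lemma sum_list_tail_block [simp]:
  "sum_list (map val (tail_block m b c)) = m * (c + of_bool b)"
  by (auto simp: tail_block_def sum_list_replicate)

lemma sorted_wrt_tail_block: "sorted_wrt super_rel (tail_block m b c)"
proof -
  have "sorted_wrt super_rel (replicate c (m, False))"
    by (simp add: sorted_wrt_iff_nth_less super_rel_def)
  thus ?thesis by (auto simp: tail_block_def super_rel_def)
qed

text \<open>After the first part of value m, \<open>super_rel\<close> leaves only non-overlined
  copies of m. Hence a flag and a multiplicity determine the final block.\<close>

lemma split_tail_block: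
  assumes "sorted_wrt super_rel xs" and "\<forall>p\<in>set xs. m \<le> val p"
  shows "xs = filter (\<lambda>p. m < val p) xs @
           tail_block m ((m, True) \<in> set xs) (count_list xs (m, False))"
  using assms
proof (induction xs)
  case (Cons p xs)
  show ?case
  proof (cases "m < val p")
    case True
    hence "(m, True) \<noteq> p" "(m, False) \<noteq> p" by auto
    thus ?thesis using Cons True by auto
  next
    case False
    hence p: "val p = m" using Cons.prems by auto
    have "r = (m, False)" if "r \<in> set xs" for r
    proof -
      have "super_rel p r" "m \<le> val r" using that Cons.prems by auto
      thus ?thesis using p by (intro prod_eqI) (auto simp: super_rel_def)
    qed
    hence xs: "xs = replicate (length xs) (m, False)"
      by (metis replicate_eqI)
    have "xs = tail_block m False (length xs)"
      using xs by (simp add: tail_block_def)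
    moreover have "count_list xs (m, False) = length xs"
      by (subst xs) (simp add: count_list_replicate)
    moreover have "(m, True) \<notin> set xs" by (subst xs) simp
    moreover have "filter (\<lambda>p. m < val p) xs = []" by (subst xs) simp
    ultimately show ?thesis using p by (cases p) (auto simp: tail_block_def)
  qed
qed (simp add: tail_block_def)

text \<open>The configurations counted by D(m,j). The strict bound makes j = 0 the empty set, which
  starts the recurrence in j.\<close>

definition gordon :: "nat \<Rightarrow> nat \<Rightarrow> nat \<Rightarrow> nat \<Rightarrow> part list set" where
  "gordon k m j n = {xs. sorted_wrt super_rel xs \<and> (\<forall>p\<in>set xs. m \<le> val p) \<and>
     sum_list (map val xs) = n \<and> occupancy_bounded k xs \<and> count_list xs (m, False) < j}"

lemma count_list_eq_0: "x \<notin> set xs \<Longrightarrow> count_list xs x = 0"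
  by (simp add: count_list_0_iff)

text \<open>Only the inequality at v = m involves both \<open>ys\<close> and the block. The one at v
  = m-1 sees the block alone and reduces to c < k.\<close>

lemma occupancy_bounded_append_tail_block:
  assumes "\<forall>p\<in>set ys. m < val p" and "c < k"
  shows "occupancy_bounded k (ys @ tail_block m b c) \<longleftrightarrow>
     occupancy_bounded k ys \<and> count_list ys (Suc m, False) + of_bool b + c < k"
proof -
  have 0: "count_list ys (v, b') = 0" if "v \<le> m" for v b'
    using assms(1) that by (intro count_list_eq_0) auto
  have eq: "count_list (ys @ tail_block m b c) (Suc v, False) +
      count_list (ys @ tail_block m b c) (v, True) + count_list (ys @ tail_block m b c) (v, False) =
     (if v = m then count_list ys (Suc m, False) + of_bool b + c
      else if Suc v = m then c
      else count_list ys (Suc v, False) + count_list ys (v, True) + count_list ys (v, False))" for v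
    using 0[of v] 0[of "Suc v"] by auto
  show ?thesis
  proof (intro iffI conjI)
    assume *: "occupancy_bounded k (ys @ tail_block m b c)"
    show m: "count_list ys (Suc m, False) + of_bool b + c < k"
      using *[unfolded occupancy_bounded_def eq, rule_format, of m] by simp
    show "occupancy_bounded k ys"
      unfolding occupancy_bounded_def
    proof
      fix v
      show "count_list ys (Suc v, False) + count_list ys (v, True) + count_list ys (v, False) < k"
        using *[unfolded occupancy_bounded_def eq, rule_format, of v] 0[of v] 0[of "Suc v"] m assms(2)
        by (auto split: if_splits)
    qed
  next
    assume "occupancy_bounded k ys \<and> count_list ys (Suc m, False) + of_bool b + c < k"
    thus "occupancy_bounded k (ys @ tail_block m b c)"
      using assms(2) unfolding occupancy_bounded_def eq by simp
  qed
qed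

text \<open>The inequality at v = m becomes the bound f(m+1) < k - c - b on what remains. This is
  why the same family, with smallest value m+1, appears on the right.\<close>

lemma append_tail_block_in_gordon_iff:
  assumes ys: "\<forall>p\<in>set ys. m < val p" and "c < k"
  shows "ys @ tail_block m b c \<in> gordon k m j n \<longleftrightarrow>
    c < j \<and> (\<exists>n'. n' + m * (c + of_bool b) = n \<and> ys \<in> gordon k (Suc m) (k - c - of_bool b) n')"
proof -
  have "sorted_wrt super_rel (ys @ tail_block m b c) \<longleftrightarrow> sorted_wrt super_rel ys"
    using ys by (auto simp: sorted_wrt_append sorted_wrt_tail_block super_rel_def dest!: set_tail_block)
  moreover have "count_list ys (m, False) = 0"
    using ys by (intro count_list_eq_0) auto
  moreover have "\<forall>p\<in>set (ys @ tail_block m b c). m \<le> val p"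
    using ys by (auto dest: set_tail_block)
  ultimately show ?thesis
    unfolding gordon_def mem_Collect_eq occupancy_bounded_append_tail_block[OF assms]
    using ys by (auto simp: Suc_le_eq)
qed

lemma finite_bounded_sum_lists:
  "finite {xs :: part list. (\<forall>p\<in>set xs. 0 < val p) \<and> sum_list (map val xs) = n}"
proof (rule finite_subset)
  show "finite {xs :: part list. set xs \<subseteq> {..n} \<times> UNIV \<and> length xs \<le> n}"
    by (rule finite_lists_length_le) auto
  have "length xs \<le> sum_list (map val xs)" if "\<forall>p\<in>set xs. 0 < val p" for xs :: "part list"
    using that by (induction xs) auto
  moreover have "val p \<le> sum_list (map val xs)" if "p \<in> set xs" for p and xs :: "part list"
    using that by (simp add: member_le_sum_list)
  ultimately show "{xs :: part list. (\<forall>p\<in>set xs. 0 < val p) \<and> sum_list (map val xs) = n}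
      \<subseteq> {xs. set xs \<subseteq> {..n} \<times> UNIV \<and> length xs \<le> n}"
    by fastforce
qed

lemma finite_gordon: "0 < m \<Longrightarrow> finite (gordon k m j n)"
  by (rule finite_subset[OF _ finite_bounded_sum_lists[of n]]) (auto simp: gordon_def)

text \<open>Multiplication by q^a at the level of sets. Sizes below a need their own case, since n -
  a would be truncated to 0.\<close>

definition shifted :: "(nat \<Rightarrow> 'a set) \<Rightarrow> nat \<Rightarrow> nat \<Rightarrow> 'a set" where
  "shifted S a n = (if n < a then {} else S (n - a))"

lemma in_shifted_iff: "x \<in> shifted S a n \<longleftrightarrow> (\<exists>n'. n' + a = n \<and> x \<in> S n')"
proof
  assume "x \<in> shifted S a n"
  thus "\<exists>n'. n' + a = n \<and> x \<in> S n'"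
    by (intro exI[of _ "n - a"]) (auto simp: shifted_def split: if_splits)
qed (auto simp: shifted_def)

text \<open>Either f(m) < j, or f(m) = j and the final block has j plain copies of m without or with
  an overlined one.\<close>

lemma gordon_Suc:
  assumes "j < k"
  shows "gordon k m (Suc j) n = gordon k m j n \<union>
     (\<lambda>ys. ys @ tail_block m False j) ` shifted (gordon k (Suc m) (k - j)) (m * j) n \<union>
     (\<lambda>ys. ys @ tail_block m True j) ` shifted (gordon k (Suc m) (k - Suc j)) (m * Suc j) n"
    (is "_ = _ \<union> ?B \<union> ?C")
proof (intro equalityI subsetI)
  fix xs assume xs: "xs \<in> gordon k m (Suc j) n"
  define ys where "ys = filter (\<lambda>p. m < val p) xs"
  define b where "b = ((m, True) \<in> set xs)"
  show "xs \<in> gordon k m j n \<union> ?B \<union> ?C"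
  proof (cases "count_list xs (m, False) = j")
    case True
    have eq: "xs = ys @ tail_block m b j"
      using split_tail_block[of xs m] xs True unfolding gordon_def ys_def b_def by auto
    moreover have "\<forall>p\<in>set ys. m < val p" by (simp add: ys_def)
    ultimately have "\<exists>n'. n' + m * (j + of_bool b) = n \<and> ys \<in> gordon k (Suc m) (k - j - of_bool b) n'"
      using xs append_tail_block_in_gordon_iff[of ys m j k b "Suc j" n] assms by simp
    thus ?thesis using eq by (cases b) (auto simp: in_shifted_iff)
  next
    case False
    thus ?thesis using xs by (auto simp: gordon_def)
  qed
next
  fix xs assume "xs \<in> gordon k m j n \<union> ?B \<union> ?C"
  moreover have "ys @ tail_block m b j \<in> gordon k m (Suc j) n"
    if "ys \<in> shifted (gordon k (Suc m) (k - j - of_bool b)) (m * (j + of_bool b)) n" for ys b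
  proof -
    have "\<forall>p\<in>set ys. m < val p" using that by (auto simp: in_shifted_iff gordon_def Suc_le_eq)
    thus ?thesis
      using that append_tail_block_in_gordon_iff[of ys m j k b "Suc j" n] assms
      by (auto simp: in_shifted_iff)
  qed
  from this[of _ False] this[of _ True] have "?B \<union> ?C \<subseteq> gordon k m (Suc j) n"
    by auto
  moreover have "gordon k m j n \<subseteq> gordon k m (Suc j) n" by (auto simp: gordon_def)
  ultimately show "xs \<in> gordon k m (Suc j) n" by blast
qed

lemma card_gordon_Suc:
  assumes "j < k" and "0 < m"
  shows "card (gordon k m (Suc j) n) = card (gordon k m j n) +
     card (shifted (gordon k (Suc m) (k - j)) (m * j) n) +
     card (shifted (gordon k (Suc m) (k - Suc j)) (m * Suc j) n)"
proof -
  define B where "B = (\<lambda>ys. ys @ tail_block m False j) `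
    shifted (gordon k (Suc m) (k - j)) (m * j) n"
  define C where "C = (\<lambda>ys. ys @ tail_block m True j) `
    shifted (gordon k (Suc m) (k - Suc j)) (m * Suc j) n"
  have fin: "finite (shifted (gordon k (Suc m) j') a n)" for j' a
    by (simp add: shifted_def finite_gordon)
  have 0: "count_list ys (m, b) = 0" if "ys \<in> shifted (gordon k (Suc m) j') a n" for ys j' a b
    using that by (intro count_list_eq_0) (auto simp: in_shifted_iff gordon_def)
  have B: "count_list xs (m, False) = j" "count_list xs (m, True) = 0" if "xs \<in> B" for xs
    using that 0 by (auto simp: B_def)
  have C: "count_list xs (m, False) = j" "count_list xs (m, True) = 1" if "xs \<in> C" for xs
    using that 0 by (auto simp: C_def)
  have A: "count_list xs (m, False) < j" if "xs \<in> gordon k m j n" for xs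
    using that by (simp add: gordon_def)
  have disj: "B \<inter> C = {}" "gordon k m j n \<inter> (B \<union> C) = {}"
    using A B C by (metis disjoint_iff zero_neq_one, metis UnE disjoint_iff less_irrefl)
  have "finite B" "finite C" using fin by (simp_all add: B_def C_def)
  hence "card (gordon k m (Suc j) n) = card (gordon k m j n) + (card B + card C)"
    unfolding gordon_Suc[OF assms(1)] Un_assoc B_def[symmetric] C_def[symmetric]
    using disj assms(2) by (simp add: card_Un_disjoint finite_gordon)
  thus ?thesis by (simp add: B_def C_def card_image inj_on_def)
qed

lemma gordon_0: "gordon k m 0 n = {}"
  by (simp add: gordon_def)

text \<open>The boundary condition: D(m,j) is 1 modulo q^m for j > 0.\<close>

lemma gordon_of_large_parts:
  assumes "n < m" and "0 < j" and "0 < k"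
  shows "gordon k m j n = (if n = 0 then {[]} else {})"
proof -
  have "xs = []" if "xs \<in> gordon k m j n" for xs
  proof (rule ccontr)
    assume "xs \<noteq> []"
    then obtain p ps where "xs = p # ps" by (cases xs) auto
    thus False using that assms(1) by (auto simp: gordon_def)
  qed
  moreover have "[] \<in> gordon k m j n \<longleftrightarrow> n = 0"
    using assms by (auto simp: gordon_def occupancy_bounded_def)
  ultimately show ?thesis by auto
qed

text \<open>Here the tail block has value 0 and no plain copies, so its flag records whether the
  overlined 0 is present. If it is, it uses up one unit of the bound on f(1), turning i into i-1.
  The inequality at v = 0 follows from f(1) + g(0) < i < k.\<close>

lemma card_superpartitions:
  assumes "2 \<le> i" and "i \<le> k - 1"
  shows "card {xs. superpartition n xs \<and> difference_condition k xs \<and>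
                   count_list xs (1, False) + count_list xs (0, True) \<le> i - 1}
       = card (gordon k 1 i n) + card (gordon k 1 (i - 1) n)"
proof -
  let ?S = "{xs. superpartition n xs \<and> difference_condition k xs \<and>
                 count_list xs (1, False) + count_list xs (0, True) \<le> i - 1}"
  have S: "xs \<in> ?S \<longleftrightarrow> sorted_wrt super_rel xs \<and> (0, False) \<notin> set xs \<and> sum_list (map val xs) = n \<and>
      occupancy_bounded k xs \<and> count_list xs (1, False) + count_list xs (0, True) < i" for xs
    using difference_condition_imp_occupancy_bounded[of xs k]
      occupancy_bounded_imp_difference_condition[of xs k] assms
    by (auto simp: superpartition_iff)
  have S_append: "ys @ tail_block 0 b 0 \<in> ?S \<longleftrightarrow> ys \<in> gordon k 1 (i - of_bool b) n"
    if ys: "\<forall>p\<in>set ys. 0 < val p" for ys b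
  proof -
    have "count_list ys (0, b') = 0" for b'
      using ys by (intro count_list_eq_0) auto
    moreover have "sorted_wrt super_rel (ys @ tail_block 0 b 0) \<longleftrightarrow> sorted_wrt super_rel ys"
      using ys by (auto simp: sorted_wrt_append sorted_wrt_tail_block super_rel_def dest!: set_tail_block)
    moreover have "(0, False) \<notin> set (ys @ tail_block 0 b 0)"
      using ys by (auto simp: tail_block_def)
    ultimately show ?thesis
      unfolding S occupancy_bounded_append_tail_block[OF ys] gordon_def mem_Collect_eq
      using ys assms by (subst occupancy_bounded_append_tail_block[OF ys]) (auto simp: Suc_le_eq)
  qed
  have "?S = gordon k 1 i n \<union> (\<lambda>ys. ys @ tail_block 0 True 0) ` gordon k 1 (i - 1) n"
  proof (intro equalityI subsetI)
    fix xs assume xs: "xs \<in> ?S"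
    define ys where "ys = filter (\<lambda>p. 0 < val p) xs"
    define b where "b = ((0, True) \<in> set xs)"
    have "xs = ys @ tail_block 0 b 0"
      using split_tail_block[of xs 0] xs unfolding S ys_def b_def by (auto simp: count_list_eq_0)
    moreover have "\<forall>p\<in>set ys. 0 < val p" by (simp add: ys_def)
    ultimately show "xs \<in> gordon k 1 i n \<union> (\<lambda>ys. ys @ tail_block 0 True 0) ` gordon k 1 (i - 1) n"
      using xs S_append[of ys b] by (cases b) (auto simp: tail_block_def)
  next
    fix xs assume "xs \<in> gordon k 1 i n \<union> (\<lambda>ys. ys @ tail_block 0 True 0) ` gordon k 1 (i - 1) n"
    moreover have "\<forall>p\<in>set ys. 0 < val p" if "ys \<in> gordon k 1 j n" for ys j
      using that by (auto simp: gordon_def)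
    ultimately show "xs \<in> ?S"
      using S_append[of _ False] S_append[of _ True] by (fastforce simp: tail_block_def)
  qed
  moreover have "ys @ tail_block 0 True 0 \<notin> gordon k 1 i n" for ys
    by (simp add: gordon_def tail_block_def)
  hence "gordon k 1 i n \<inter> (\<lambda>ys. ys @ tail_block 0 True 0) ` gordon k 1 (i - 1) n = {}"
    by blast
  moreover have "inj_on (\<lambda>ys. ys @ tail_block 0 True 0) (gordon k 1 (i - 1) n)"
    by (simp add: inj_on_def)
  ultimately show ?thesis
    by (simp only: card_Un_disjoint finite_gordon finite_imageI card_image zero_less_one)
qed

section \<open>Overpartitions\<close>

definition overpartitions_le :: "(nat \<Rightarrow> bool) \<Rightarrow> nat \<Rightarrow> nat \<Rightarrow> part list set" where
  "overpartitions_le ok L n = {xs. sorted_wrt over_rel xs \<and> sum_list (map val xs) = n \<and>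
     (\<forall>p\<in>set xs. 0 < val p \<and> val p \<le> L \<and> (\<not> overlined p \<longrightarrow> ok (val p)))}"

lemma finite_overpartitions_le: "finite (overpartitions_le ok L n)"
  by (rule finite_subset[OF _ finite_bounded_sum_lists[of n]]) (auto simp: overpartitions_le_def)

lemma overpartitions_le_0: "overpartitions_le ok 0 n = (if n = 0 then {[]} else {})"
proof -
  have "xs = []" if "xs \<in> overpartitions_le ok 0 n" for xs
    using that by (cases xs) (auto simp: overpartitions_le_def)
  moreover have "[] \<in> overpartitions_le ok 0 n \<longleftrightarrow> n = 0"
    by (auto simp: overpartitions_le_def)
  ultimately show ?thesis by auto
qed

text \<open>An overlined first part is the final occurrence of its value, so the rest is at most L;
  a plain one may be followed by further copies of L+1.\<close>

lemma Cons_in_overpartitions_le_iff: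
  "(Suc L, b) # ys \<in> overpartitions_le ok (Suc L) n \<longleftrightarrow>
     (b \<or> ok (Suc L)) \<and> ys \<in> shifted (overpartitions_le ok (if b then L else Suc L)) (Suc L) n"
proof (cases b)
  case True
  thus ?thesis by (auto simp: in_shifted_iff overpartitions_le_def over_rel_def less_Suc_eq_le)
next
  case False
  thus ?thesis by (auto simp: in_shifted_iff overpartitions_le_def over_rel_def)
qed

text \<open>Classification by the first part. The last set refers again to the bound L+1 at a
  smaller sum, which produces the geometric factor 1/(1 - q^(L+1)).\<close>

lemma overpartitions_le_Suc:
  "overpartitions_le ok (Suc L) n = overpartitions_le ok L n \<union>
     Cons (Suc L, True) ` shifted (overpartitions_le ok L) (Suc L) n \<union>
     (if ok (Suc L) then Cons (Suc L, False) ` shifted (overpartitions_le ok (Suc L)) (Suc L) n else {})"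
    (is "_ = _ \<union> ?B \<union> ?C")
proof (intro equalityI subsetI)
  fix xs assume xs: "xs \<in> overpartitions_le ok (Suc L) n"
  show "xs \<in> overpartitions_le ok L n \<union> ?B \<union> ?C"
  proof (cases "xs \<noteq> [] \<and> val (hd xs) = Suc L")
    case True
    then obtain b ys where "xs = (Suc L, b) # ys" by (cases xs) auto
    thus ?thesis using xs Cons_in_overpartitions_le_iff[of L b ys ok n] by (cases b) auto
  next
    case False
    have "val p \<le> L" if p: "p \<in> set xs" for p
    proof -
      obtain h ys where h: "xs = h # ys" using p by (cases xs) auto
      hence "val h \<le> L" using False xs by (auto simp: overpartitions_le_def)
      moreover have "val p \<le> val h"
        using p xs h by (auto simp: overpartitions_le_def over_rel_def)
      ultimately show ?thesis by simp
    qed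
    thus ?thesis using xs by (auto simp: overpartitions_le_def)
  qed
next
  fix xs assume "xs \<in> overpartitions_le ok L n \<union> ?B \<union> ?C"
  moreover have "overpartitions_le ok L n \<subseteq> overpartitions_le ok (Suc L) n"
    by (auto simp: overpartitions_le_def)
  moreover have "?B \<subseteq> overpartitions_le ok (Suc L) n" "?C \<subseteq> overpartitions_le ok (Suc L) n"
    using Cons_in_overpartitions_le_iff[of L True _ ok n]
      Cons_in_overpartitions_le_iff[of L False _ ok n] by auto
  ultimately show "xs \<in> overpartitions_le ok (Suc L) n" by blast
qed

lemma card_overpartitions_le_Suc:
  "card (overpartitions_le ok (Suc L) n) = card (overpartitions_le ok L n) +
     card (shifted (overpartitions_le ok L) (Suc L) n) +
     (if ok (Suc L) then card (shifted (overpartitions_le ok (Suc L)) (Suc L) n) else 0)"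
proof -
  let ?B = "Cons (Suc L, True) ` shifted (overpartitions_le ok L) (Suc L) n"
  let ?C = "if ok (Suc L) then Cons (Suc L, False) ` shifted (overpartitions_le ok (Suc L)) (Suc L) n else {}"
  have fin: "finite (shifted (overpartitions_le ok L') a n)" for L' a
    by (simp add: shifted_def finite_overpartitions_le)
  have "?B \<inter> ?C = {}" "overpartitions_le ok L n \<inter> (?B \<union> ?C) = {}"
    by (auto simp: overpartitions_le_def split: if_splits)
  hence "card (overpartitions_le ok (Suc L) n) = card (overpartitions_le ok L n) + (card ?B + card ?C)"
    unfolding overpartitions_le_Suc[of ok L n] Un_assoc
    using fin by (simp add: card_Un_disjoint finite_overpartitions_le)
  thus ?thesis by (simp add: card_image)
qed

lemma overpartitions_eq_overpartitions_le:
  assumes "n \<le> L"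
  shows "{xs. overpartition n xs \<and> (\<forall>p\<in>set xs. \<not> overlined p \<longrightarrow> ok (val p))} = overpartitions_le ok L n"
proof -
  have "val p \<le> sum_list (map val xs)" if "p \<in> set xs" for p and xs :: "part list"
    using that by (simp add: member_le_sum_list)
  thus ?thesis
    using assms unfolding overpartition_iff overpartitions_le_def by fastforce
qed

section \<open>Truncated power series and q-binomials\<close>

definition fps_eq_upto :: "nat \<Rightarrow> 'a::comm_ring_1 fps \<Rightarrow> 'a fps \<Rightarrow> bool" where
  "fps_eq_upto K f g \<longleftrightarrow> (\<forall>n<K. fps_nth f n = fps_nth g n)"

lemma fps_eq_upto_refl [simp]: "fps_eq_upto K f f"
  by (simp add: fps_eq_upto_def)

lemma fps_eq_upto_sym: "fps_eq_upto K f g \<Longrightarrow> fps_eq_upto K g f"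
  by (simp add: fps_eq_upto_def)

lemma fps_eq_upto_trans [trans]:
  "fps_eq_upto K f g \<Longrightarrow> fps_eq_upto K g h \<Longrightarrow> fps_eq_upto K f h"
  by (simp add: fps_eq_upto_def)

lemma fps_eq_upto_eq_trans [trans]:
  "f = g \<Longrightarrow> fps_eq_upto K g h \<Longrightarrow> fps_eq_upto K f h"
  "fps_eq_upto K f g \<Longrightarrow> g = h \<Longrightarrow> fps_eq_upto K f h"
  by simp_all

lemma fps_eq_upto_mono: "fps_eq_upto K f g \<Longrightarrow> K' \<le> K \<Longrightarrow> fps_eq_upto K' f g"
  by (simp add: fps_eq_upto_def)

lemma fps_eq_upto_add:
  "fps_eq_upto K f g \<Longrightarrow> fps_eq_upto K f' g' \<Longrightarrow> fps_eq_upto K (f + f') (g + g')"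
  by (simp add: fps_eq_upto_def)

lemma fps_eq_upto_diff:
  "fps_eq_upto K f g \<Longrightarrow> fps_eq_upto K f' g' \<Longrightarrow> fps_eq_upto K (f - f') (g - g')"
  by (simp add: fps_eq_upto_def)

lemma fps_eq_upto_mult:
  "fps_eq_upto K f g \<Longrightarrow> fps_eq_upto K f' g' \<Longrightarrow> fps_eq_upto K (f * f') (g * g')"
  by (auto simp: fps_eq_upto_def fps_mult_nth intro!: sum.cong)

lemma fps_eq_upto_sum:
  "(\<And>x. x \<in> A \<Longrightarrow> fps_eq_upto K (f x) (g x)) \<Longrightarrow> fps_eq_upto K (sum f A) (sum g A)"
  by (auto simp: fps_eq_upto_def fps_sum_nth intro!: sum.cong)

lemma fps_eq_upto_X_power_mult:
  "fps_eq_upto K f g \<Longrightarrow> fps_eq_upto (a + K) (fps_X ^ a * f) (fps_X ^ a * g)"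
  by (auto simp: fps_eq_upto_def fps_X_power_mult_nth)

lemma fps_eq_upto_X_power_mult_0: "K \<le> a \<Longrightarrow> fps_eq_upto K (fps_X ^ a * f) 0"
  by (simp add: fps_eq_upto_def fps_X_power_mult_nth)

lemma fps_eq_upto_X_power_0: "K \<le> a \<Longrightarrow> fps_eq_upto K (fps_X ^ a) 0"
  using fps_eq_upto_X_power_mult_0[of K a 1] by simp

section \<open>q-factorials and Gaussian binomials\<close>

abbreviation q :: "rat fps" where "q \<equiv> fps_X"

text \<open>The q-Pochhammer symbols (x;x)_n and, below, (-q;q)_n. The base x is kept free because
  both q and q^(2k) occur.\<close>

definition qfact :: "rat fps \<Rightarrow> nat \<Rightarrow> rat fps" where
  "qfact x n = (\<Prod>a=1..n. 1 - x ^ a)"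

definition qfact_plus :: "nat \<Rightarrow> rat fps" where
  "qfact_plus n = (\<Prod>a=1..n. 1 + q ^ a)"

lemma qfact_0 [simp]: "qfact x 0 = 1"
  by (simp add: qfact_def)

lemma qfact_Suc: "qfact x (Suc n) = qfact x n * (1 - x ^ Suc n)"
  by (simp add: qfact_def)

lemma qfact_plus_0 [simp]: "qfact_plus 0 = 1"
  by (simp add: qfact_plus_def)

lemma qfact_plus_Suc: "qfact_plus (Suc n) = qfact_plus n * (1 + q ^ Suc n)"
  by (simp add: qfact_plus_def)

lemma nth_0_qfact: "fps_nth x 0 = 0 \<Longrightarrow> fps_nth (qfact x n) 0 = 1"
  by (induction n) (auto simp: qfact_Suc)

lemma nth_0_qfact_plus: "fps_nth (qfact_plus n) 0 = 1"
  by (induction n) (auto simp: qfact_plus_Suc)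

lemma inverse_mult_qfact: "fps_nth x 0 = 0 \<Longrightarrow> inverse (qfact x n) * qfact x n = 1"
  by (rule inverse_mult_eq_1) (simp add: nth_0_qfact)

lemma inverse_mult_qfact_plus: "inverse (qfact_plus n) * qfact_plus n = 1"
  by (rule inverse_mult_eq_1) (simp add: nth_0_qfact_plus)

lemma inverse_mult_one_minus_X_power: "inverse (1 - q ^ Suc n) * (1 - q ^ Suc n) = 1"
  by (rule inverse_mult_eq_1) simp

lemma inverse_mult_one_plus_X_power: "inverse (1 + q ^ Suc n) * (1 + q ^ Suc n) = 1"
  by (rule inverse_mult_eq_1) simp

text \<open>Every factor with index above n is 1 modulo q^(b(n+1)).\<close>

lemma qfact_eq_upto:
  assumes "n \<le> n'" and "0 < b"
  shows "fps_eq_upto (b * Suc n) (qfact (q ^ b) n') (qfact (q ^ b) n)"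
  using assms(1)
proof (induction n' rule: dec_induct)
  case (step n')
  have "b * Suc n \<le> b * Suc n'" using step by simp
  hence "fps_eq_upto (b * Suc n) (1 - (q ^ b) ^ Suc n') (1 - 0)"
    unfolding power_mult[symmetric]
    by (intro fps_eq_upto_diff fps_eq_upto_X_power_0 fps_eq_upto_refl)
  from fps_eq_upto_mult[OF step.IH this] show ?case by (simp add: qfact_Suc)
qed simp

lemma qfact_plus_eq_upto:
  assumes "n \<le> n'"
  shows "fps_eq_upto (Suc n) (qfact_plus n') (qfact_plus n)"
  using assms
proof (induction n' rule: dec_induct)
  case (step n')
  have "Suc n \<le> Suc n'" using step by simp
  hence "fps_eq_upto (Suc n) (1 + q ^ Suc n') (1 + 0)"
    by (intro fps_eq_upto_add fps_eq_upto_X_power_0 fps_eq_upto_refl)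
  from fps_eq_upto_mult[OF step.IH this] show ?case by (simp add: qfact_plus_Suc)
qed simp

fun qbinomial :: "'a::comm_ring_1 \<Rightarrow> nat \<Rightarrow> nat \<Rightarrow> 'a" where
  "qbinomial x n 0 = 1"
| "qbinomial x 0 (Suc r) = 0"
| "qbinomial x (Suc n) (Suc r) = qbinomial x n r + x ^ Suc r * qbinomial x n (Suc r)"

lemma qbinomial_eq_0: "n < r \<Longrightarrow> qbinomial x n r = 0"
  by (induction x n r rule: qbinomial.induct) auto

text \<open>Homogeneous in a and b, so that the triple product can be derived without negative
  powers of q. The induction splits off the factor r = 0 and replaces b by bx in the rest; the
  q-Pascal rule then merges neighbouring terms.\<close>

lemma qbinomial_theorem:
  fixes a b x :: "'a::comm_ring_1"
  shows "(\<Prod>r<M. a + b * x ^ r) =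
    (\<Sum>r\<le>M. x ^ (r choose 2) * qbinomial x M r * b ^ r * a ^ (M - r))"
proof (induction M arbitrary: b)
  case (Suc M)
  define h where "h r = x ^ (r choose 2) * qbinomial x M r * (b * x) ^ r * a ^ (M - r)" for r
  have "(\<Prod>r<Suc M. a + b * x ^ r) = (a + b) * (\<Prod>r<M. a + (b * x) * x ^ r)"
    by (simp add: prod.lessThan_Suc_shift mult.assoc del: prod.lessThan_Suc)
  also have "\<dots> = (a + b) * (\<Sum>r\<le>M. h r)"
    by (simp add: Suc.IH h_def)
  also have "\<dots> = (\<Sum>r\<le>M. a * h r) + (\<Sum>r\<le>M. b * h r)"
    by (simp add: distrib_right sum_distrib_left sum.distrib)
  also have "(\<Sum>r\<le>M. a * h r) = a * h 0 + (\<Sum>r\<le>M. a * h (Suc r))"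
  proof -
    have "(\<Sum>r\<le>M. a * h r) = (\<Sum>r\<le>Suc M. a * h r)"
      by (simp add: h_def qbinomial_eq_0)
    thus ?thesis by (simp only: sum.atMost_Suc_shift)
  qed
  also have "a * h 0 + (\<Sum>r\<le>M. a * h (Suc r)) + (\<Sum>r\<le>M. b * h r) =
      a * h 0 + (\<Sum>r\<le>M. a * h (Suc r) + b * h r)"
    by (simp add: sum.distrib add.assoc)
  also have "(\<Sum>r\<le>M. a * h (Suc r) + b * h r) = (\<Sum>r\<le>M. x ^ (Suc r choose 2) *
      qbinomial x (Suc M) (Suc r) * b ^ Suc r * a ^ (Suc M - Suc r))"
  proof (rule sum.cong)
    fix r assume "r \<in> {..M}"
    have choose: "Suc r choose 2 = r + (r choose 2)"
      by (simp add: numeral_2_eq_2)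
    have "a * h (Suc r) = x ^ (Suc r choose 2) * (x ^ Suc r * qbinomial x M (Suc r)) * b ^ Suc r * a ^ (M - r)"
    proof (cases "r = M")
      case True
      thus ?thesis by (simp add: h_def qbinomial_eq_0)
    next
      case False
      hence "M - r = Suc (M - Suc r)" using \<open>r \<in> {..M}\<close> by simp
      thus ?thesis by (simp add: h_def power_mult_distrib algebra_simps)
    qed
    moreover have "b * h r = x ^ (Suc r choose 2) * qbinomial x M r * b ^ Suc r * a ^ (M - r)"
      by (simp add: h_def choose power_add power_mult_distrib algebra_simps)
    ultimately show "a * h (Suc r) + b * h r = x ^ (Suc r choose 2) *
      qbinomial x (Suc M) (Suc r) * b ^ Suc r * a ^ (Suc M - Suc r)"
      by (simp add: algebra_simps)
  qed simp
  also have "a * h 0 = x ^ (0 choose 2) * qbinomial x (Suc M) 0 * b ^ 0 * a ^ (Suc M - 0)"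
    by (simp add: h_def)
  finally show ?case
    by (simp only: sum.atMost_Suc_shift)
qed (simp add: numeral_2_eq_2)

text \<open>In multiplied form no q-factorial has to be invertible. The inductive step rests on (1 -
  x^(r+1)) + x^(r+1) (1 - x^(n-r)) = 1 - x^(n+1).\<close>

lemma qbinomial_mult_qfact:
  "r \<le> n \<Longrightarrow> qbinomial x n r * qfact x r * qfact x (n - r) = qfact x n"
proof (induction x n r rule: qbinomial.induct)
  case (3 x n r)
  hence "qbinomial x n r * qfact x r * qfact x (n - r) = qfact x n" by simp
  moreover have "qbinomial x n (Suc r) * qfact x (Suc r) * qfact x (n - r) =
      qfact x n * (1 - x ^ (n - r))"
  proof (cases "r = n")
    case True
    thus ?thesis by (simp add: qbinomial_eq_0)
  next
    case False
    hence "n - r = Suc (n - Suc r)" and "Suc r \<le> n" using 3 by auto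
    thus ?thesis using 3 by (simp add: qfact_Suc mult.assoc)
  qed
  moreover have "x ^ Suc r * x ^ (n - r) = x ^ Suc n"
    using 3 by (simp flip: power_add power_Suc)
  moreover have "(B1 + y * B2) * (f * (1 - y)) * g = F * (1 - w)"
    if "B1 * f * g = F" "B2 * (f * (1 - y)) * g = F * (1 - z)" "y * z = w"
    for B1 B2 f g F w y z :: "rat fps"
  proof -
    have "(B1 + y * B2) * (f * (1 - y)) * g = (B1 * f * g) * (1 - y) + y * (B2 * (f * (1 - y)) * g)"
      by (simp add: algebra_simps)
    also have "\<dots> = F * (1 - y * z)"
      unfolding that(1,2) by (simp add: algebra_simps)
    finally show ?thesis using that by simp
  qed
  ultimately show ?case by (simp only: qfact_Suc qbinomial.simps diff_Suc_Suc)
qed auto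


text \<open>With Q = q^b the product is (Q;Q)_N (Q;Q)_2N / ((Q;Q)_(N-s) (Q;Q)_(N+s)). All four
  factors agree with (Q;Q)_(N-s) modulo Q^(N-s+1), so they cancel.\<close>

lemma central_qbinomial_eq_upto:
  assumes "0 < b" and "s \<le> N" and "r = N - s \<or> r = N + s"
  shows "fps_eq_upto (b * Suc (N - s)) (qfact (q ^ b) N * qbinomial (q ^ b) (2 * N) r) 1"
proof -
  define B where "B = qbinomial (q ^ b) (2 * N) r"
  define K where "K = b * Suc (N - s)"
  let ?f = "qfact (q ^ b)"
  have upto: "fps_eq_upto K (?f a) (?f (N - s))" if "N - s \<le> a" for a
    unfolding K_def using that assms(1) by (rule qfact_eq_upto)
  have "B * ?f r * ?f (2 * N - r) = ?f (2 * N)"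
    unfolding B_def by (rule qbinomial_mult_qfact) (use assms in auto)
  moreover have "2 * N - (N - s) = N + s" "2 * N - (N + s) = N - s"
    using assms(2) by auto
  ultimately have prod: "B * ?f (N - s) * ?f (N + s) = ?f (2 * N)"
    using assms(3) by (auto simp: algebra_simps)
  have inv: "inverse (?f (N + s)) * ?f (N + s) = 1"
    by (rule inverse_mult_qfact) (use assms(1) in simp)
  have "fps_eq_upto K (?f N * B) (?f (N - s) * B)"
    by (intro fps_eq_upto_mult upto) auto
  also have "?f (N - s) * B = inverse (?f (N + s)) * (B * ?f (N - s) * ?f (N + s))"
    using inv by (simp add: algebra_simps)
  also have "\<dots> = inverse (?f (N + s)) * ?f (2 * N)"
    by (simp only: prod)
  also have "fps_eq_upto K \<dots> (inverse (?f (N + s)) * ?f (N + s))"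
  proof (rule fps_eq_upto_mult[OF fps_eq_upto_refl])
    show "fps_eq_upto K (?f (2 * N)) (?f (N + s))"
      using assms(2) by (intro fps_eq_upto_trans[OF upto fps_eq_upto_sym[OF upto]]) auto
  qed
  also note inv
  finally show ?thesis by (simp add: B_def K_def)
qed

section \<open>The triple product\<close>

lemma sum_lessThan_add:
  fixes f :: "nat \<Rightarrow> 'a::comm_monoid_add"
  shows "(\<Sum>r<m + n. f r) = (\<Sum>r<m. f r) + (\<Sum>r<n. f (m + r))"
  by (induction n) (simp_all add: add.assoc)

lemma prod_lessThan_add:
  fixes f :: "nat \<Rightarrow> 'a::comm_monoid_mult"
  shows "(\<Prod>r<m + n. f r) = (\<Prod>r<m. f r) * (\<Prod>r<n. f (m + r))"
  by (induction n) (simp_all add: mult.assoc)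

text \<open>Folds a sum about its centre, as a two-sided theta sum is folded by n -> -n-1; index 0
  is left without a partner.\<close>

lemma sum_atMost_double_pairing:
  fixes h :: "nat \<Rightarrow> 'a::comm_monoid_add"
  shows "(\<Sum>r\<le>2 * N. h r) = h 0 + (\<Sum>n<N. h (N - n) + h (Suc (N + n)))"
proof -
  have "(\<Sum>r\<le>2 * N. h r) = (\<Sum>r<Suc N + N. h r)"
    by (rule sum.cong) auto
  also have "\<dots> = (\<Sum>r<Suc N. h r) + (\<Sum>n<N. h (Suc (N + n)))"
    unfolding sum_lessThan_add by simp
  also have "(\<Sum>r<Suc N. h r) = h 0 + (\<Sum>r<N. h (Suc r))"
    by (rule sum.lessThan_Suc_shift)
  also have "(\<Sum>r<N. h (Suc r)) = (\<Sum>n<N. h (Suc (N - Suc n)))"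
    by (rule sum.nat_diff_reindex[symmetric])
  also have "\<dots> = (\<Sum>n<N. h (N - n))"
    by (rule sum.cong) (auto simp: Suc_diff_Suc)
  finally show ?thesis by (simp add: sum.distrib add.assoc)
qed

text \<open>The factors of the triple product with exponents congruent to j or -j modulo 2k;
  \<open>qfact (q ^ (2 * k)) N\<close> supplies those with exponents divisible by 2k.\<close>

definition theta_prod :: "nat \<Rightarrow> nat \<Rightarrow> nat \<Rightarrow> rat fps" where
  "theta_prod k j N = (\<Prod>r<N. (1 - q ^ (2 * k * r + j)) * (1 - q ^ (2 * k * r + (2 * k - j))))"

lemma mult_choose_two: "2 * k * (r choose 2) = k * (r * (r - 1))"
proof -
  have "even (r * (r - 1))" by (cases r) auto
  thus ?thesis by (simp add: choose_two)
qed

text \<open>The q-binomial theorem for 2N factors Q^N - q^j Q^r with Q = q^(2k). The upper half r >=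
  N yields the factors for j, the reversed lower half those for 2k-j, and the extracted monomials
  combine to (-1)^N q^A. The same monomial divides every term of the folded sum and is cancelled at
  the end.\<close>

lemma finite_Jacobi_triple_product:
  assumes "0 < j" and "j < k"
  shows "theta_prod k j N = (-1) ^ N * q ^ (k * N * N + (k - j) * N) +
    (\<Sum>n<N. (-1) ^ n * (q ^ (k * n * n + (k - j) * n) * qbinomial (q ^ (2 * k)) (2 * N) (N - n)
       - q ^ (k * n * n + k * n + j * n + j) * qbinomial (q ^ (2 * k)) (2 * N) (Suc (N + n))))"
proof -
  define Q where "Q = q ^ (2 * k)"
  define A where "A = 2 * k * (N * N) + j * N + k * (N * (N - 1))"
  define h where "h r = Q ^ (r choose 2) * qbinomial Q (2 * N) r * (- (q ^ j)) ^ r * (Q ^ N) ^ (2 * N - r)" for r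
  have h: "h r = (-1) ^ r * q ^ (k * (r * (r - 1)) + j * r + 2 * k * (N * (2 * N - r))) * qbinomial Q (2 * N) r" for r
  proof -
    have 1: "Q ^ (r choose 2) = q ^ (k * (r * (r - 1)))"
      unfolding Q_def power_mult[symmetric] mult_choose_two ..
    have 2: "(- (q ^ j)) ^ r = (-1) ^ r * q ^ (j * r)"
      by (subst power_minus) (simp add: power_mult)
    have 3: "(Q ^ N) ^ (2 * N - r) = q ^ (2 * k * (N * (2 * N - r)))"
      by (simp add: Q_def mult.assoc flip: power_mult)
    show ?thesis unfolding h_def 1 2 3 by (simp only: power_add mult_ac)
  qed
  have upper: "(\<Prod>r<N. Q ^ N + - (q ^ j) * Q ^ (N + r)) = q ^ (2 * k * (N * N)) * (\<Prod>r<N. 1 - q ^ (2 * k * r + j))"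
  proof -
    have "(\<Prod>r<N. Q ^ N + - (q ^ j) * Q ^ (N + r)) = (\<Prod>r<N. q ^ (2 * k * N) * (1 - q ^ (2 * k * r + j)))"
      by (rule prod.cong) (simp_all add: Q_def algebra_simps flip: power_mult power_add)
    also have "\<dots> = (q ^ (2 * k * N)) ^ N * (\<Prod>r<N. 1 - q ^ (2 * k * r + j))"
      by (simp add: prod.distrib)
    also have "(q ^ (2 * k * N)) ^ N = q ^ (2 * k * (N * N))"
      by (simp add: mult.assoc flip: power_mult)
    finally show ?thesis .
  qed
  have lower: "(\<Prod>r<N. Q ^ N + - (q ^ j) * Q ^ r) =
      (-1) ^ N * q ^ (j * N + k * (N * (N - 1))) * (\<Prod>r<N. 1 - q ^ (2 * k * r + (2 * k - j)))"
  proof -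
    have "(\<Prod>r<N. Q ^ N + - (q ^ j) * Q ^ r) = (\<Prod>r<N. Q ^ N + - (q ^ j) * Q ^ (N - Suc r))"
      by (rule prod.nat_diff_reindex[symmetric])
    also have "\<dots> = (\<Prod>r<N. (- (q ^ j)) * Q ^ (N - Suc r) * (1 - q ^ (2 * k * r + (2 * k - j))))"
    proof (rule prod.cong)
      fix r assume "r \<in> {..<N}"
      then obtain d where d: "N = Suc r + d" by (auto simp: less_iff_Suc_add)
      obtain e where e: "k = j + e" using assms(2) less_imp_add_positive by blast
      have "Q ^ N = q ^ j * Q ^ d * q ^ (2 * k * r + (2 * k - j))"
        by (simp add: Q_def d e algebra_simps flip: power_mult power_add)
      thus "Q ^ N + - (q ^ j) * Q ^ (N - Suc r) =
          (- (q ^ j)) * Q ^ (N - Suc r) * (1 - q ^ (2 * k * r + (2 * k - j)))"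
        by (simp add: d algebra_simps)
    qed simp
    also have "\<dots> = (- (q ^ j)) ^ N * (\<Prod>r<N. Q ^ (N - Suc r)) * (\<Prod>r<N. 1 - q ^ (2 * k * r + (2 * k - j)))"
      by (simp only: prod.distrib prod_constant card_lessThan)
    also have "(\<Prod>r<N. Q ^ (N - Suc r)) = (\<Prod>r<N. Q ^ r)"
      by (rule prod.nat_diff_reindex)
    also have "\<dots> = Q ^ (N choose 2)"
      by (induction N) (simp_all add: power_add numeral_2_eq_2)
    also have "\<dots> = q ^ (k * (N * (N - 1)))"
      unfolding Q_def power_mult[symmetric] mult_choose_two ..
    also have "(- (q ^ j)) ^ N = (-1) ^ N * q ^ (j * N)"
      by (subst power_minus) (simp add: power_mult)
    finally show ?thesis by (simp add: power_add mult.assoc)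
  qed
  have "(\<Prod>r<2 * N. Q ^ N + - (q ^ j) * Q ^ r) =
      (\<Prod>r<N. Q ^ N + - (q ^ j) * Q ^ r) * (\<Prod>r<N. Q ^ N + - (q ^ j) * Q ^ (N + r))"
    unfolding mult_2 prod_lessThan_add ..
  also have "\<dots> = (-1) ^ N * q ^ A * theta_prod k j N"
    unfolding upper lower theta_prod_def A_def by (simp only: power_add prod.distrib mult_ac)
  finally have "(-1) ^ N * q ^ A * theta_prod k j N = (\<Sum>r\<le>2 * N. h r)"
    unfolding h_def qbinomial_theorem by simp
  also have "\<dots> = h 0 + (\<Sum>n<N. h (N - n) + h (Suc (N + n)))"
    by (rule sum_atMost_double_pairing)
  also have "h 0 = (-1) ^ N * q ^ A * ((-1) ^ N * q ^ (k * N * N + (k - j) * N))"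
  proof -
    obtain e where e: "k = j + e" using assms(2) less_imp_add_positive by blast
    have exponent: "2 * k * (N * (2 * N)) = A + (k * N * N + (k - j) * N)"
      unfolding A_def e by (cases N) (simp_all add: algebra_simps)
    have "h 0 = q ^ (2 * k * (N * (2 * N)))"
      by (simp add: h)
    also have "\<dots> = q ^ A * q ^ (k * N * N + (k - j) * N)"
      unfolding exponent by (rule power_add)
    also have "\<dots> = ((-1) ^ N * (-1) ^ N) * (q ^ A * q ^ (k * N * N + (k - j) * N))"
      by (simp flip: power_mult_distrib)
    finally show ?thesis by (simp only: mult_ac)
  qed
  also have "(\<Sum>n<N. h (N - n) + h (Suc (N + n))) = (\<Sum>n<N. (-1) ^ N * q ^ A *
     ((-1) ^ n * (q ^ (k * n * n + (k - j) * n) * qbinomial Q (2 * N) (N - n)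
       - q ^ (k * n * n + k * n + j * n + j) * qbinomial Q (2 * N) (Suc (N + n)))))"
  proof (rule sum.cong)
    fix n assume "n \<in> {..<N}"
    then obtain d where d: "N = Suc (n + d)" by (auto simp: less_iff_Suc_add)
    obtain e where e: "k = j + e" using assms(2) less_imp_add_positive by blast
    have 1: "k * ((N - n) * (N - n - 1)) + j * (N - n) + 2 * k * (N * (2 * N - (N - n))) =
        A + (k * n * n + (k - j) * n)"
      unfolding A_def e d by (simp add: algebra_simps)
    have 2: "k * (Suc (N + n) * (Suc (N + n) - 1)) + j * Suc (N + n) + 2 * k * (N * (2 * N - Suc (N + n))) =
        A + (k * n * n + k * n + j * n + j)"
      unfolding A_def e d by (simp add: algebra_simps)
    have 3: "(-1) ^ (N - n) = (-1 :: rat fps) ^ (N + n)"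
      unfolding d by (simp add: power_add flip: power_mult_distrib)
    have "h (N - n) = (-1) ^ N * q ^ A * ((-1) ^ n * (q ^ (k * n * n + (k - j) * n) * qbinomial Q (2 * N) (N - n)))"
      unfolding h 1 3 by (simp only: power_add mult_ac)
    moreover have "h (Suc (N + n)) = - ((-1) ^ N * q ^ A *
        ((-1) ^ n * (q ^ (k * n * n + k * n + j * n + j) * qbinomial Q (2 * N) (Suc (N + n)))))"
      unfolding h 2 by (simp add: power_add mult_ac)
    ultimately show "h (N - n) + h (Suc (N + n)) = (-1) ^ N * q ^ A *
     ((-1) ^ n * (q ^ (k * n * n + (k - j) * n) * qbinomial Q (2 * N) (N - n)
       - q ^ (k * n * n + k * n + j * n + j) * qbinomial Q (2 * N) (Suc (N + n))))"
      by (simp only: right_diff_distrib) simp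
  qed simp
  finally have "(-1) ^ N * q ^ A * theta_prod k j N = (-1) ^ N * q ^ A *
    ((-1) ^ N * q ^ (k * N * N + (k - j) * N) +
    (\<Sum>n<N. (-1) ^ n * (q ^ (k * n * n + (k - j) * n) * qbinomial Q (2 * N) (N - n)
       - q ^ (k * n * n + k * n + j * n + j) * qbinomial Q (2 * N) (Suc (N + n)))))"
    by (simp only: distrib_left sum_distrib_left)
  moreover have "(-1) ^ N * q ^ A \<noteq> 0" by simp
  ultimately show ?thesis unfolding Q_def using mult_left_cancel by blast
qed

text \<open>After multiplication by (Q;Q)_N each binomial may be replaced by 1. Far from the centre
  this is less accurate, but there the quadratic exponent makes up for it; the unpaired term
  vanishes modulo q^N.\<close>

lemma theta_prod_eq_upto:
  assumes "0 < j" and "j < k"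
  shows "fps_eq_upto N (qfact (q ^ (2 * k)) N * theta_prod k j N)
    (\<Sum>n<N. (-1) ^ n * (q ^ (k * n * n + (k - j) * n) * (1 - q ^ (j * (2 * n + 1)))))"
proof -
  define F where "F = qfact (q ^ (2 * k)) N"
  define B where "B = qbinomial (q ^ (2 * k)) (2 * N)"
  have FB: "fps_eq_upto N (q ^ a * (F * B r)) (q ^ a * 1)"
    if "s \<le> N" "r = N - s \<or> r = N + s" "N \<le> a + 2 * k * Suc (N - s)" for a r s
    using fps_eq_upto_X_power_mult[OF central_qbinomial_eq_upto[of "2 * k" s N r], of a] that assms
    unfolding F_def B_def by (auto intro: fps_eq_upto_mono)
  have le: "N \<le> 2 * k * N" using assms by simp
  have "F * theta_prod k j N = q ^ (k * N * N + (k - j) * N) * (F * (-1) ^ N) +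
     (\<Sum>n<N. (-1) ^ n * (q ^ (k * n * n + (k - j) * n) * (F * B (N - n))
       - q ^ (k * n * n + k * n + j * n + j) * (F * B (Suc (N + n)))))"
    unfolding finite_Jacobi_triple_product[OF assms] B_def[symmetric]
    by (simp add: distrib_left sum_distrib_left right_diff_distrib mult_ac)
  also have "fps_eq_upto N \<dots> (0 + (\<Sum>n<N. (-1) ^ n * (q ^ (k * n * n + (k - j) * n) * 1
       - q ^ (k * n * n + k * n + j * n + j) * 1)))"
  proof (intro fps_eq_upto_add fps_eq_upto_sum)
    have "N \<le> k * N * N" using assms mult_le_mono[of 1 "k * N" N N] by (cases N) simp_all
    thus "fps_eq_upto N (q ^ (k * N * N + (k - j) * N) * (F * (-1) ^ N)) 0"
      by (intro fps_eq_upto_X_power_mult_0 trans_le_add1)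
  next
    fix n assume "n \<in> {..<N}"
    then obtain d where d: "N = Suc (n + d)" by (auto simp: less_iff_Suc_add)
    have nn: "n \<le> n * n" by (cases n) auto
    \<comment> \<open>From (n-1)^2 >= 0: exponent plus accuracy of the binomial is then at least
      2kN.\<close>
    have "2 * n \<le> n * n + 1"
      by (cases n) (auto simp: algebra_simps)
    hence "k * (2 * n) \<le> k * (n * n + 1)" by (rule mult_le_mono2)
    hence "2 * k * N \<le> (k * n * n + (k - j) * n) + 2 * k * Suc (N - n)"
      unfolding d by (simp add: algebra_simps)
    hence 1: "fps_eq_upto N (q ^ (k * n * n + (k - j) * n) * (F * B (N - n))) (q ^ (k * n * n + (k - j) * n) * 1)"
      using le d by (intro FB[of n]) auto
    have "k * n \<le> k * (n * n)" using nn by (rule mult_le_mono2)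
    moreover have "2 * k * N = k * n + k * n + 2 * k * Suc (N - Suc n)" "k * n * n = k * (n * n)"
      by (simp_all add: d algebra_simps)
    ultimately have "2 * k * N \<le> (k * n * n + k * n + j * n + j) + 2 * k * Suc (N - Suc n)"
      by linarith
    hence 2: "fps_eq_upto N (q ^ (k * n * n + k * n + j * n + j) * (F * B (Suc (N + n))))
        (q ^ (k * n * n + k * n + j * n + j) * 1)"
      using le d by (intro FB[of "Suc n"]) auto
    show "fps_eq_upto N ((-1) ^ n * (q ^ (k * n * n + (k - j) * n) * (F * B (N - n))
          - q ^ (k * n * n + k * n + j * n + j) * (F * B (Suc (N + n)))))
        ((-1) ^ n * (q ^ (k * n * n + (k - j) * n) * 1 - q ^ (k * n * n + k * n + j * n + j) * 1))"
      by (rule fps_eq_upto_mult[OF fps_eq_upto_refl fps_eq_upto_diff[OF 1 2]])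
  qed
  also have "0 + (\<Sum>n<N. (-1) ^ n * (q ^ (k * n * n + (k - j) * n) * 1
       - q ^ (k * n * n + k * n + j * n + j) * 1)) =
    (\<Sum>n<N. (-1) ^ n * (q ^ (k * n * n + (k - j) * n) * (1 - q ^ (j * (2 * n + 1)))))"
  proof -
    have "k * n * n + k * n + j * n + j = (k * n * n + (k - j) * n) + j * (2 * n + 1)" for n
    proof -
      obtain e where e: "k = j + e" using assms(2) less_imp_add_positive by blast
      show ?thesis unfolding e by (simp add: algebra_simps)
    qed
    thus ?thesis by (simp only: power_add right_diff_distrib mult_1_right add_0_left)
  qed
  finally show ?thesis by (simp only: F_def)
qed

section \<open>Andrews' recurrence\<close>

text \<open>What remains of (-q;q)_n (-q^(n+m+1);q)_inf / ((q;q)_n (q^(n+m+1);q)_inf) after division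
  by (-q;q)_inf / (q;q)_inf. Only finite products are left.\<close>

definition ratio :: "nat \<Rightarrow> nat \<Rightarrow> rat fps" where
  "ratio n m = qfact_plus n * qfact q (n + m) * inverse (qfact q n) * inverse (qfact_plus (n + m))"

lemma ratio_0_right: "ratio n 0 = 1"
  using inverse_mult_qfact[of q n] inverse_mult_qfact_plus[of n]
  by (simp add: ratio_def mult_ac)

lemma ratio_Suc_left: "(1 - q ^ Suc n) * ratio (Suc n) m = (1 + q ^ Suc n) * ratio n (Suc m)"
proof -
  have "ratio (Suc n) m = qfact_plus n * (1 + q ^ Suc n) * qfact q (Suc (n + m)) *
      (inverse (qfact q n) * inverse (1 - q ^ Suc n)) * inverse (qfact_plus (Suc (n + m)))"
    by (simp only: ratio_def add_Suc qfact_plus_Suc[of n] qfact_Suc[of q n] fps_inverse_mult)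
  hence "(1 - q ^ Suc n) * ratio (Suc n) m = (inverse (1 - q ^ Suc n) * (1 - q ^ Suc n)) *
     ((1 + q ^ Suc n) * (qfact_plus n * qfact q (Suc (n + m)) * inverse (qfact q n) *
       inverse (qfact_plus (Suc (n + m)))))"
    by (simp only: mult_ac)
  thus ?thesis unfolding inverse_mult_one_minus_X_power by (simp add: ratio_def)
qed

lemma ratio_Suc_right:
  "(1 - q ^ Suc (n + m)) * ratio n m = (1 + q ^ Suc (n + m)) * ratio n (Suc m)"
proof -
  have "ratio n (Suc m) = qfact_plus n * (qfact q (n + m) * (1 - q ^ Suc (n + m))) *
      inverse (qfact q n) * (inverse (qfact_plus (n + m)) * inverse (1 + q ^ Suc (n + m)))"
    by (simp only: ratio_def add_Suc_right qfact_plus_Suc qfact_Suc fps_inverse_mult)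
  hence "(1 + q ^ Suc (n + m)) * ratio n (Suc m) =
      (inverse (1 + q ^ Suc (n + m)) * (1 + q ^ Suc (n + m))) *
     ((1 - q ^ Suc (n + m)) * (qfact_plus n * qfact q (n + m) * inverse (qfact q n) *
       inverse (qfact_plus (n + m))))"
    by (simp only: mult_ac)
  also have "\<dots> = (1 - q ^ Suc (n + m)) * ratio n m"
    by (simp only: inverse_mult_one_plus_X_power mult_1_left ratio_def)
  finally show ?thesis ..
qed

text \<open>
  The n-th term of Andrews' H_{k,j}(-1/q; q^(m+1); q), divided by the factor
  (1+q)(1+q^2).../((1-q)(1-q^2)...), which depends on none of m, j, n.
\<close>

definition andrews_term :: "nat \<Rightarrow> nat \<Rightarrow> nat \<Rightarrow> nat \<Rightarrow> rat fps" where
  "andrews_term k m j n =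
     (-1) ^ n * (q ^ (k * n * n + (k - j) * n + m * k * n) * (1 - q ^ (j * (m + 2 * n + 1)))) * ratio n m"

definition andrews_sum :: "nat \<Rightarrow> nat \<Rightarrow> nat \<Rightarrow> nat \<Rightarrow> rat fps" where
  "andrews_sum k m j N = (\<Sum>n<N. andrews_term k m j n)"

text \<open>The recurrence of D, satisfied termwise up to a shift: the increase in j contributes
  a(n) + b(n), the two terms with m+1 contribute a(n+1) + b(n). As a(0) = 0, the sums differ only by
  a(N), which is divisible by q^(kN^2).\<close>

lemma andrews_sum_Suc:
  assumes "j < k"
  shows "fps_eq_upto N (andrews_sum k m (Suc j) N)
    (andrews_sum k m j N + q ^ (Suc m * j) * andrews_sum k (Suc m) (k - j) N
       + q ^ (Suc m * Suc j) * andrews_sum k (Suc m) (k - Suc j) N)"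
proof -
  obtain d where k: "k = Suc (j + d)" using assms by (auto simp: less_iff_Suc_add)
  \<comment> \<open>The difference of the terms for j+1 and j has four monomials; they pair up with
    common factors 1 - q^n and 1 - q^(n+m+1). These are the factors that let
    \<open>ratio_Suc_left\<close> (at n+1) and \<open>ratio_Suc_right\<close> pass from m to
    m+1.\<close>
  define a where "a n = q ^ (k * n * n + d * n + m * k * n) * ((1 - q ^ n) * ratio n m) * (-1) ^ n" for n
  define b where "b n = q ^ (k * n * n + k * n + m * k * n + j * Suc (n + m)) *
      ((1 - q ^ Suc (n + m)) * ratio n m) * (-1) ^ n" for n
  have diff: "andrews_term k m (Suc j) n - andrews_term k m j n = a n + b n" for n
  proof -
    let ?e = "k * n * n + d * n + m * k * n"
    have e: "k - j = Suc d" "k - Suc j = d" by (simp_all add: k)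
    have 1: "k * n * n + Suc d * n + m * k * n = ?e + n"
      by (simp add: algebra_simps)
    have 2: "?e + n + j * (m + 2 * n + 1) = k * n * n + k * n + m * k * n + j * Suc (n + m)"
      unfolding k by (simp add: algebra_simps)
    have 3: "?e + Suc j * (m + 2 * n + 1) =
        k * n * n + k * n + m * k * n + j * Suc (n + m) + Suc (n + m)"
      unfolding k by (simp add: algebra_simps)
    have "q ^ ?e * (1 - q ^ (Suc j * (m + 2 * n + 1))) - q ^ (?e + n) * (1 - q ^ (j * (m + 2 * n + 1))) =
      q ^ ?e - q ^ (?e + Suc j * (m + 2 * n + 1)) - q ^ (?e + n) + q ^ (?e + n + j * (m + 2 * n + 1))"
      by (simp only: power_add[of q ?e] power_add[of q "?e + n"]) (simp add: algebra_simps)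
    also have "\<dots> = q ^ ?e * (1 - q ^ n) +
        q ^ (k * n * n + k * n + m * k * n + j * Suc (n + m)) * (1 - q ^ Suc (n + m))"
      unfolding 2 3 power_add[of q _ n] power_add[of q _ "Suc (n + m)"]
      by (simp only: right_diff_distrib) simp
    finally have main: "q ^ ?e * (1 - q ^ (Suc j * (m + 2 * n + 1))) -
        q ^ (?e + n) * (1 - q ^ (j * (m + 2 * n + 1))) = \<dots>" .
    have "andrews_term k m (Suc j) n - andrews_term k m j n =
      (-1) ^ n * (q ^ ?e * (1 - q ^ (Suc j * (m + 2 * n + 1))) -
        q ^ (?e + n) * (1 - q ^ (j * (m + 2 * n + 1)))) * ratio n m"
      unfolding andrews_term_def e 1 by (simp only: left_diff_distrib right_diff_distrib)
    thus ?thesis unfolding main a_def b_def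
      by (simp only: distrib_left distrib_right mult_ac)
  qed
  have shift: "q ^ (Suc m * j) * andrews_term k (Suc m) (k - j) n +
      q ^ (Suc m * Suc j) * andrews_term k (Suc m) (k - Suc j) n = a (Suc n) + b n" for n
  proof -
    let ?e = "k * n * n + k * n + m * k * n + j * Suc (n + m)"
    let ?f = "k * Suc n * Suc n + d * Suc n + m * k * Suc n"
    have e: "k - (k - j) = j" "k - (k - Suc j) = Suc j" "k - j = Suc d" "k - Suc j = d"
      by (simp_all add: k)
    have 1: "Suc m * j + (k * n * n + j * n + Suc m * k * n) = ?e"
      by (simp add: algebra_simps)
    have 2: "Suc m * Suc j + (k * n * n + Suc j * n + Suc m * k * n) = ?e + Suc (n + m)"
      by (simp add: algebra_simps)
    have q1: "q ^ ?e = q ^ (Suc m * j) * q ^ (k * n * n + j * n + Suc m * k * n)"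
      unfolding 1[symmetric] by (rule power_add)
    have q2: "q ^ (?e + Suc (n + m)) = q ^ (Suc m * Suc j) * q ^ (k * n * n + Suc j * n + Suc m * k * n)"
      unfolding 2[symmetric] by (rule power_add)
    have 3: "?e + Suc d * (Suc m + 2 * n + 1) = ?f + Suc n"
      unfolding k by (simp add: algebra_simps)
    have 4: "?e + Suc (n + m) + d * (Suc m + 2 * n + 1) = ?f"
      unfolding k by (simp add: algebra_simps)
    have "q ^ (Suc m * j) * andrews_term k (Suc m) (k - j) n +
        q ^ (Suc m * Suc j) * andrews_term k (Suc m) (k - Suc j) n =
      (-1) ^ n * (q ^ ?e * (1 - q ^ (Suc d * (Suc m + 2 * n + 1))) +
        q ^ (?e + Suc (n + m)) * (1 - q ^ (d * (Suc m + 2 * n + 1)))) * ratio n (Suc m)"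
      unfolding andrews_term_def e(1,2) q1 q2 unfolding e(3,4)
      by (simp only: distrib_left distrib_right mult_ac)
    also have "q ^ ?e * (1 - q ^ (Suc d * (Suc m + 2 * n + 1))) +
        q ^ (?e + Suc (n + m)) * (1 - q ^ (d * (Suc m + 2 * n + 1))) =
        q ^ ?e - q ^ (?e + Suc d * (Suc m + 2 * n + 1)) +
        q ^ (?e + Suc (n + m)) - q ^ (?e + Suc (n + m) + d * (Suc m + 2 * n + 1))"
      by (simp only: power_add[of q ?e "Suc d * _"] power_add[of q "?e + Suc (n + m)"] right_diff_distrib)
         simp
    also have "\<dots> = q ^ ?e * (1 + q ^ Suc (n + m)) - q ^ ?f * (1 + q ^ Suc n)"
      unfolding 3 4 power_add[of q _ "Suc n"] power_add[of q ?e "Suc (n + m)"]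
      by (simp only: distrib_left) simp
    finally show ?thesis
      unfolding a_def b_def ratio_Suc_left ratio_Suc_right
      by (simp only: left_diff_distrib right_diff_distrib mult_ac power_Suc) simp
  qed
  have telescope: "(\<Sum>n<N. a (Suc n)) = (\<Sum>n<N. a n) + a N"
  proof -
    have "a 0 = 0" by (simp add: a_def)
    thus ?thesis using sum_lessThan_telescope[of a N] by (simp add: sum_subtractf algebra_simps)
  qed
  have "(\<Sum>n<N. andrews_term k m (Suc j) n) - (\<Sum>n<N. andrews_term k m j n) =
      (\<Sum>n<N. a n) + (\<Sum>n<N. b n)"
    by (simp only: sum_subtractf[symmetric] diff sum.distrib)
  hence "andrews_sum k m (Suc j) N = andrews_sum k m j N + ((\<Sum>n<N. a n) + (\<Sum>n<N. b n))"
    unfolding andrews_sum_def by (simp add: algebra_simps)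
  moreover have "q ^ (Suc m * j) * andrews_sum k (Suc m) (k - j) N +
      q ^ (Suc m * Suc j) * andrews_sum k (Suc m) (k - Suc j) N =
      (\<Sum>n<N. a n) + (\<Sum>n<N. b n) + a N"
  proof -
    have "q ^ (Suc m * j) * andrews_sum k (Suc m) (k - j) N +
      q ^ (Suc m * Suc j) * andrews_sum k (Suc m) (k - Suc j) N = (\<Sum>n<N. a (Suc n) + b n)"
      unfolding andrews_sum_def sum_distrib_left sum.distrib[symmetric] shift ..
    thus ?thesis by (simp add: sum.distrib telescope algebra_simps)
  qed
  moreover have "fps_eq_upto N (a N) 0"
  proof -
    have "N \<le> k * N * N" using k by (cases N) simp_all
    thus ?thesis unfolding a_def mult.assoc[of "q ^ _"]
      by (intro fps_eq_upto_X_power_mult_0 trans_le_add1)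
  qed
  ultimately show ?thesis
    by (simp add: fps_eq_upto_def algebra_simps)
qed

lemma andrews_sum_0: "andrews_sum k m 0 N = 0"
  by (simp add: andrews_sum_def andrews_term_def)

text \<open>Truncation of (-q;q)_inf / (q;q)_inf, the factor divided out of
  \<open>andrews_term\<close>.\<close>

definition euler_quotient :: "nat \<Rightarrow> rat fps" where
  "euler_quotient L = qfact_plus L * inverse (qfact q L)"

text \<open>At m = K all terms with n > 0 contain q^(Kkn) and vanish modulo q^K. The term n = 0
  reduces to (q;q)_K / (-q;q)_K, which cancels the Euler quotient.\<close>

lemma andrews_sum_large:
  assumes "0 < j" and "0 < k" and "K \<le> L"
  shows "fps_eq_upto K (euler_quotient L * andrews_sum k K j K) 1"
proof (cases K)
  case (Suc K')
  have term0: "fps_eq_upto K (andrews_term k K j 0) (ratio 0 K)"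
  proof -
    have "K \<le> j * (K + 1)" using assms(1) mult_le_mono[of 1 j K "K + 1"] by simp
    hence "fps_eq_upto K (1 - q ^ (j * (K + 1))) (1 - 0)"
      by (intro fps_eq_upto_diff fps_eq_upto_refl fps_eq_upto_X_power_0)
    hence "fps_eq_upto K ((1 - q ^ (j * (K + 1))) * ratio 0 K) ((1 - 0) * ratio 0 K)"
      by (rule fps_eq_upto_mult) simp
    thus ?thesis by (simp add: andrews_term_def)
  qed
  have terms: "fps_eq_upto K (andrews_term k K j (Suc n)) 0" for n
  proof -
    have "K * 1 \<le> K * (k * Suc n)" using assms(2) by (intro mult_le_mono2) simp
    hence "K \<le> K * k * Suc n" by (simp only: mult.assoc mult_1_right)
    hence "fps_eq_upto K (q ^ (k * Suc n * Suc n + (k - j) * Suc n + K * k * Suc n) *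
        ((-1) ^ Suc n * (1 - q ^ (j * (K + 2 * Suc n + 1))) * ratio (Suc n) K)) 0"
      by (intro fps_eq_upto_X_power_mult_0 trans_le_add2)
    thus ?thesis unfolding andrews_term_def by (simp only: mult_ac)
  qed
  have "andrews_sum k K j K = andrews_term k K j 0 + (\<Sum>n<K'. andrews_term k K j (Suc n))"
    by (simp add: andrews_sum_def Suc sum.lessThan_Suc_shift del: sum.lessThan_Suc)
  moreover have "fps_eq_upto K (andrews_term k K j 0 + (\<Sum>n<K'. andrews_term k K j (Suc n)))
      (ratio 0 K + (\<Sum>n<K'. 0))"
    by (intro fps_eq_upto_add fps_eq_upto_sum term0 terms)
  ultimately have "fps_eq_upto K (andrews_sum k K j K) (ratio 0 K)" by simp
  hence "fps_eq_upto K (euler_quotient L * andrews_sum k K j K) (euler_quotient L * ratio 0 K)"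
    by (intro fps_eq_upto_mult fps_eq_upto_refl)
  also have "euler_quotient L * ratio 0 K =
      (inverse (qfact q L) * qfact q K) * (inverse (qfact_plus K) * qfact_plus L)"
    by (simp add: euler_quotient_def ratio_def mult_ac)
  also have "fps_eq_upto K \<dots> ((inverse (qfact q L) * qfact q L) *
      (inverse (qfact_plus K) * qfact_plus K))"
  proof (intro fps_eq_upto_mult fps_eq_upto_refl)
    show "fps_eq_upto K (qfact q K) (qfact q L)"
      using qfact_eq_upto[OF assms(3), of 1] by (auto intro: fps_eq_upto_sym fps_eq_upto_mono)
    show "fps_eq_upto K (qfact_plus L) (qfact_plus K)"
      using qfact_plus_eq_upto[OF assms(3)] by (auto intro: fps_eq_upto_mono)
  qed
  also have "\<dots> = 1" by (simp add: inverse_mult_qfact inverse_mult_qfact_plus)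
  finally show ?thesis .
qed (simp add: fps_eq_upto_def)

section \<open>Generating functions\<close>

definition gordon_gf :: "nat \<Rightarrow> nat \<Rightarrow> nat \<Rightarrow> rat fps" where
  "gordon_gf k m j = Abs_fps (\<lambda>n. of_nat (card (gordon k m j n)))"

lemma gordon_gf_Suc:
  assumes "j < k" and "0 < m"
  shows "gordon_gf k m (Suc j) = gordon_gf k m j + q ^ (m * j) * gordon_gf k (Suc m) (k - j)
     + q ^ (m * Suc j) * gordon_gf k (Suc m) (k - Suc j)"
  by (rule fps_ext)
    (simp add: gordon_gf_def card_gordon_Suc[OF assms] fps_X_power_mult_nth shifted_def
      del: mult_Suc_right)

text \<open>Induction downwards from m = K, where for j > 0 both sides are 1 modulo q^K; an inner
  induction raises j by the common recurrence. The index m belongs to x = q^(m+1), hence to smallest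
  part m+1. L stays free so that it can later be a multiple of 2k.\<close>

lemma gordon_gf_eq_andrews_sum:
  assumes "0 < k" and "K \<le> L" and "m \<le> K" and "j \<le> k"
  shows "fps_eq_upto K (gordon_gf k (Suc m) j) (euler_quotient L * andrews_sum k m j K)"
  using assms(3,4)
proof (induction m arbitrary: j rule: inc_induct)
  case base
  show ?case
  proof (cases "j = 0")
    case True
    thus ?thesis by (simp add: andrews_sum_0 gordon_gf_def gordon_0 fps_eq_upto_def)
  next
    case False
    have "fps_eq_upto K (gordon_gf k (Suc K) j) 1"
      using False assms(1) by (simp add: fps_eq_upto_def gordon_gf_def gordon_of_large_parts)
    also have "fps_eq_upto K 1 (euler_quotient L * andrews_sum k K j K)"
      using False assms(1,2) by (intro fps_eq_upto_sym[OF andrews_sum_large]) auto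
    finally show ?thesis .
  qed
next
  case (step m)
  from step.prems show ?case
  proof (induction j)
    case 0
    show ?case by (simp add: andrews_sum_0 gordon_gf_def gordon_0 fps_eq_upto_def)
  next
    case (Suc j)
    let ?P = "euler_quotient L"
    have "gordon_gf k (Suc m) (Suc j) = gordon_gf k (Suc m) j
        + q ^ (Suc m * j) * gordon_gf k (Suc (Suc m)) (k - j)
        + q ^ (Suc m * Suc j) * gordon_gf k (Suc (Suc m)) (k - Suc j)"
      using Suc.prems by (intro gordon_gf_Suc) auto
    also have "fps_eq_upto K \<dots> (?P * andrews_sum k m j K
        + q ^ (Suc m * j) * (?P * andrews_sum k (Suc m) (k - j) K)
        + q ^ (Suc m * Suc j) * (?P * andrews_sum k (Suc m) (k - Suc j) K))"
      using Suc by (intro fps_eq_upto_add fps_eq_upto_mult[OF fps_eq_upto_refl] step.IH) auto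
    also have "\<dots> = ?P * (andrews_sum k m j K + q ^ (Suc m * j) * andrews_sum k (Suc m) (k - j) K
       + q ^ (Suc m * Suc j) * andrews_sum k (Suc m) (k - Suc j) K)"
      by (simp only: distrib_left mult_ac)
    also have "fps_eq_upto K \<dots> (?P * andrews_sum k m (Suc j) K)"
      using Suc.prems
      by (intro fps_eq_upto_mult[OF fps_eq_upto_refl] fps_eq_upto_sym[OF andrews_sum_Suc]) auto
    finally show ?case .
  qed
qed

section \<open>Product formula for overpartitions with restricted non-overlined parts\<close>

definition overpartition_gf :: "(nat \<Rightarrow> bool) \<Rightarrow> nat \<Rightarrow> rat fps" where
  "overpartition_gf ok L = Abs_fps (\<lambda>n. of_nat (card (overpartitions_le ok L n)))"

lemma overpartition_gf_0: "overpartition_gf ok 0 = 1"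
  by (rule fps_ext) (simp add: overpartition_gf_def overpartitions_le_0)

text \<open>Admitting the value L+1 multiplies by 1 + q^(L+1) for the overlined part and, if plain
  copies are allowed, by 1/(1 - q^(L+1)).\<close>

lemma overpartition_gf_Suc:
  "overpartition_gf ok (Suc L) * (if ok (Suc L) then 1 - q ^ Suc L else 1) =
     overpartition_gf ok L * (1 + q ^ Suc L)"
proof -
  have "overpartition_gf ok (Suc L) = overpartition_gf ok L + q ^ Suc L * overpartition_gf ok L +
      (if ok (Suc L) then q ^ Suc L * overpartition_gf ok (Suc L) else 0)"
    by (rule fps_ext)
      (simp add: overpartition_gf_def card_overpartitions_le_Suc[of ok L] fps_X_power_mult_nth shifted_def
        del: power_Suc)
  thus ?thesis by (simp add: algebra_simps split: if_splits)
qed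

lemma overpartition_gf_mult:
  "overpartition_gf ok L * (\<Prod>a | a \<in> {1..L} \<and> ok a. 1 - q ^ a) = qfact_plus L"
proof (induction L)
  case (Suc L)
  have "(\<Prod>a | a \<in> {1..Suc L} \<and> ok a. 1 - q ^ a) =
      (if ok (Suc L) then 1 - q ^ Suc L else 1) * (\<Prod>a | a \<in> {1..L} \<and> ok a. 1 - q ^ a)"
  proof (cases "ok (Suc L)")
    case True
    hence "{a. a \<in> {1..Suc L} \<and> ok a} = insert (Suc L) {a. a \<in> {1..L} \<and> ok a}" by auto
    thus ?thesis using True by simp
  next
    case False
    hence "{a. a \<in> {1..Suc L} \<and> ok a} = {a. a \<in> {1..L} \<and> ok a}" by (auto simp: le_Suc_eq)
    thus ?thesis using False by simp
  qed
  hence "overpartition_gf ok (Suc L) * (\<Prod>a | a \<in> {1..Suc L} \<and> ok a. 1 - q ^ a) =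
     overpartition_gf ok L * (1 + q ^ Suc L) * (\<Prod>a | a \<in> {1..L} \<and> ok a. 1 - q ^ a)"
    by (simp only: mult.assoc[symmetric] overpartition_gf_Suc)
  also have "\<dots> = overpartition_gf ok L * (\<Prod>a | a \<in> {1..L} \<and> ok a. 1 - q ^ a) * (1 + q ^ Suc L)"
    by (simp only: mult_ac)
  finally show ?case by (simp only: Suc qfact_plus_Suc)
qed (simp add: overpartition_gf_0)

text \<open>The congruence condition in terms of natural residues, with -j represented by
  2k-j.\<close>

definition avoids :: "nat \<Rightarrow> nat \<Rightarrow> nat \<Rightarrow> bool" where
  "avoids k j a \<longleftrightarrow> a mod (2 * k) \<notin> {0, j, 2 * k - j}"

text \<open>Each period from 2kN+1 to 2k(N+1) contains exactly three forbidden numbers, distinct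
  because 0 < j < k; they match the factors added on the right.\<close>

lemma prod_not_avoids:
  assumes "0 < j" and "j < k"
  shows "(\<Prod>a | a \<in> {1..2 * k * N} \<and> \<not> avoids k j a. 1 - q ^ a) =
    qfact (q ^ (2 * k)) N * theta_prod k j N"
proof (induction N)
  case (Suc N)
  let ?S = "\<lambda>N. {a. a \<in> {1..2 * k * N} \<and> \<not> avoids k j a}"
  have "a \<in> ?S (Suc N) \<longleftrightarrow> a \<in> ?S N \<or>
      a \<in> {2 * k * N + j, 2 * k * N + (2 * k - j), 2 * k * Suc N}" for a
  proof (cases "a \<le> 2 * k * N")
    case True
    thus ?thesis using assms by auto
  next
    case False
    then obtain r where a: "a = 2 * k * N + r" and "0 < r"
      using less_imp_add_positive[of "2 * k * N" a] by auto
    have "a mod (2 * k) = r mod (2 * k)" by (simp add: a)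
    moreover have "r mod (2 * k) = (if r = 2 * k then 0 else r)" if "r \<le> 2 * k"
      using that by auto
    ultimately show ?thesis
      using assms \<open>0 < r\<close> unfolding avoids_def by (cases "r \<le> 2 * k") (auto simp: a)
  qed
  hence S: "?S (Suc N) = insert (2 * k * N + j) (insert (2 * k * N + (2 * k - j))
      (insert (2 * k * Suc N) (?S N)))"
    by blast
  have "(\<Prod>a\<in>?S (Suc N). 1 - q ^ a) = (1 - q ^ (2 * k * N + j)) * ((1 - q ^ (2 * k * N + (2 * k - j))) *
      ((1 - q ^ (2 * k * Suc N)) * (\<Prod>a\<in>?S N. 1 - q ^ a)))"
    unfolding S using assms by (subst prod.insert; force?)+
  also have "\<dots> = qfact (q ^ (2 * k)) (Suc N) * theta_prod k j (Suc N)"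
    unfolding Suc qfact_Suc power_mult[symmetric] by (simp add: theta_prod_def mult_ac)
  finally show ?case .
qed (simp add: theta_prod_def)

text \<open>Dividing by the allowed factors amounts to dividing by (q;q)_L and multiplying by the
  forbidden ones. The latter form the theta series, which is Andrews' series at m = 0 because
  \<open>ratio n 0\<close> is 1.\<close>

lemma card_overpartitions_avoids:
  assumes "0 < j" and "j < k"
  shows "card {xs. overpartition n xs \<and> (\<forall>p\<in>set xs. \<not> overlined p \<longrightarrow> avoids k j (val p))} =
    card (gordon k 1 j n)"
proof -
  \<comment> \<open>Modulo q^(n+1) the coefficient of q^n is still visible. L covers K full periods,
    as \<open>prod_not_avoids\<close> requires, and exceeds every part of an overpartition of
    n.\<close>
  define K where "K = Suc n"
  define L where "L = 2 * k * K"
  define F where "F = overpartition_gf (avoids k j) L"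
  have KL: "K \<le> L" using assms by (simp add: L_def)
  have "qfact q L = (\<Prod>a | a \<in> {1..L} \<and> avoids k j a. 1 - q ^ a) *
      (\<Prod>a | a \<in> {1..L} \<and> \<not> avoids k j a. 1 - q ^ a)"
    unfolding qfact_def by (subst prod.union_disjoint[symmetric]) (auto intro!: prod.cong)
  hence "F * qfact q L = qfact_plus L * (qfact (q ^ (2 * k)) K * theta_prod k j K)"
    using overpartition_gf_mult[of "avoids k j" L] prod_not_avoids[OF assms, of K]
    unfolding F_def L_def by (simp only: mult.assoc[symmetric])
  hence "F * (inverse (qfact q L) * qfact q L) =
      euler_quotient L * (qfact (q ^ (2 * k)) K * theta_prod k j K)"
    unfolding euler_quotient_def by (metis (no_types, lifting) mult.assoc mult.commute)
  hence "F = euler_quotient L * (qfact (q ^ (2 * k)) K * theta_prod k j K)"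
    by (simp add: inverse_mult_qfact)
  also have "fps_eq_upto K \<dots> (euler_quotient L * andrews_sum k 0 j K)"
  proof -
    have "andrews_sum k 0 j K =
      (\<Sum>n<K. (-1) ^ n * (q ^ (k * n * n + (k - j) * n) * (1 - q ^ (j * (2 * n + 1)))))"
      by (simp add: andrews_sum_def andrews_term_def ratio_0_right)
    thus ?thesis
      by (simp only: fps_eq_upto_mult[OF fps_eq_upto_refl theta_prod_eq_upto[OF assms]])
  qed
  also have "fps_eq_upto K \<dots> (gordon_gf k (Suc 0) j)"
    using assms KL by (intro fps_eq_upto_sym[OF gordon_gf_eq_andrews_sum]) auto
  finally have "fps_nth F n = fps_nth (gordon_gf k 1 j) n"
    by (simp add: fps_eq_upto_def K_def)
  moreover have "n \<le> L" using KL by (simp add: K_def)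
  ultimately show ?thesis
    by (simp add: F_def overpartition_gf_def gordon_gf_def overpartitions_eq_overpartitions_le)
qed

lemma nonoverlined_avoid_iff:
  assumes "0 < j" and "j < k"
  shows "nonoverlined_avoid k j xs \<longleftrightarrow> (\<forall>p\<in>set xs. \<not> overlined p \<longrightarrow> avoids k j (val p))"
proof -
  have "avoids k j a \<longleftrightarrow> \<not> [int a = 0] (mod 2 * int k) \<and> \<not> [int a = int j] (mod 2 * int k) \<and>
      \<not> [int a = - int j] (mod 2 * int k)" for a
  proof -
    have mod: "int a mod (2 * int k) = int (a mod (2 * k))"
      by (simp add: zmod_int)
    have "- int j mod (2 * int k) = (2 * int k - int j) mod (2 * int k)"
      by (metis add.commute mod_add_self2 uminus_add_conv_diff)
    also have "\<dots> = int (2 * k - j)"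
      using assms by (subst mod_pos_pos_trivial) auto
    finally have neg: "- int j mod (2 * int k) = int (2 * k - j)" .
    have "int j mod (2 * int k) = int j"
      using assms by (subst mod_pos_pos_trivial) auto
    thus ?thesis
      unfolding avoids_def cong_def mod neg by simp
  qed
  thus ?thesis unfolding nonoverlined_avoid_def by simp
qed

theorem theorem7p3:
  fixes k i n :: nat
  assumes "k \<ge> 3" and "2 \<le> i" and "i \<le> k - 1"
  shows "card {xs. superpartition n xs \<and> difference_condition k xs \<and>
                   count_list xs (1, False) + count_list xs (0, True) \<le> i - 1}
       = card {xs. overpartition n xs \<and> nonoverlined_avoid k i xs}
         + card {xs. overpartition n xs \<and> nonoverlined_avoid k (i - 1) xs}"
proof -
  \<comment> \<open>Both i and i-1 lie strictly between 0 and k, so the product side applies to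
    each; i >= 2 is what makes i-1 positive.\<close>
  have i: "0 < i" "i < k" "0 < i - 1" "i - 1 < k" using assms by auto
  show ?thesis
    unfolding card_superpartitions[OF assms(2,3)] nonoverlined_avoid_iff[OF i(1,2)]
      nonoverlined_avoid_iff[OF i(3,4)] card_overpartitions_avoids[OF i(1,2)]
      card_overpartitions_avoids[OF i(3,4)] ..
qed

end
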